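(* Let $p$ be a pure-frontal singular point, and not an umbilic point, of a frontal $f$, let $\gamma$ be the singular curve through $p$, and let $\mathbf V_1,\mathbf V_2$ be the principal vectors $$\mathbf V_j=-v(\tilde M-\kappa_j\tilde F)\,\partial_u+(\tilde L-\kappa_j\tilde E)\,\partial_v\qquad(j=1,2)$$ in an orthogonal adapted coordinate system $(u,v)$ centered at $p$. Then both principal vectors $\mathbf V_j$ $(j=1,2)$ can be extended as $C^\infty$ vector fields near $p$. Moreover: (1) Suppose that $\kappa_t(p)\ne0$. Then $\mathbf V_j\neq0$ at $p$ $(j=1,2)$, and both $\mathbf V_1(p)$ and $\mathbf V_2(p)$ are parallel to the null vector $\eta$ at $p$. (2) Suppose that $\kappa_t=0$ along the singular curve through $p$. Then there exist linearly independent $C^\infty$ vector fields $\mathbf W_1,\mathbf W_2$ near $p$ such that $\mathbf V_j$ is parallel to (i.e. linearly dependent with) $\mathbf W_j$ $(j=1,2)$. (3) Suppose that $r_b/3-\kappa_\nu\ne0$ on $\gamma$. Then $\gamma$ is a curvature line if and only if $\kappa_t=0$ on $\gamma$.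
   Context: Let $V\subset\mathbb{R}^2$ be open. A $C^\infty$ map $f\colon V\to\mathbb{R}^3$ is a frontal if there is a $C^\infty$ map $\nu\colon V\to S^2$ with $\langle df_q(X),\nu(q)\rangle=0$ for all $q\in V$, $X\in T_qV$. A point is singular if $f$ is not an immersion there; $S(f)$ is the set of singular points. With $\lambda=\det(f_u,f_v,\nu)$, $p\in S(f)$ is non-degenerate if $d\lambda(p)\ne0$. Then on a neighborhood $U$ of $p$ the set $S(f)$ is the image of a regular $C^\infty$ curve $\gamma\colon(-\varepsilon,\varepsilon)\to U$, $\gamma(0)=p$ (the singular curve), and there is a nowhere-zero vector field $\eta$ on $U$ with $df_q(\eta_q)=0$ on $S(f)\cap U$ (a null vector field). $p$ is of the first kind if it is non-degenerate and $\eta$ is transverse to $\gamma$ at $p$. With $\hat\gamma=f\circ\gamma$ and $\psi(t)=\det(\hat\gamma',\nu\circ\gamma,(\eta\nu)\circ\gamma)(t)$, a singular point $p$ of the first kind is pure-frontal if $\psi\equiv0$ along $\gamma$. An adapted pair is a positively oriented pair $(\xi,\eta)$ with $\xi$ tangent to $\gamma$ along $\gamma$ and $\eta$ a null vector field. A coordinate system $(U;u,v)$ is adapted if the image of $\gamma$ is the $u$-axis and $(\partial_u,\partial_v)$ is an adapted pair; it is orthogonal adapted if moreover $|f_u(u,0)|=|f_{vv}(u,0)|=1$ and $\langle f_u,f_{vv}\rangle(u,0)=0$ (such coordinates exist). Write $f_v=vh$ with $h$ of class $C^\infty$, and $\tilde E=\langle f_u,f_u\rangle$, $\tilde F=\langle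 f_u,h\rangle$, $\tilde G=\langle h,h\rangle$, $\tilde L=-\langle f_u,\nu_u\rangle$, $\tilde M=-\langle h,\nu_u\rangle$, $\tilde N=-\langle h,\nu_v\rangle$; the unit normal is chosen with $\det(f_u,f_{vv},\nu)(u,0)>0$. Near a pure-frontal singular point the Gaussian and mean curvatures $K,H$ extend as $C^\infty$ functions to $U$; $\kappa_1=H+\sqrt{H^2-K}$, $\kappa_2=H-\sqrt{H^2-K}$ are the principal curvatures, and $q$ is an umbilic point if $(H^2-K)(q)=0$. A vector $(V_1,V_2)=V_1\partial_u+V_2\partial_v$ is a principal vector relative to $\kappa\in\{\kappa_1,\kappa_2\}$ if $\kappa\begin{pmatrix} E & F \\ F & G \end{pmatrix}\begin{pmatrix} V_1 \\ V_2 \end{pmatrix}=\begin{pmatrix} L & M \\ M & N \end{pmatrix}\begin{pmatrix} V_1 \\ V_2 \end{pmatrix}$, where $E=\tilde E$, $F=v\tilde F$, $G=v^2\tilde G$, $L=\tilde L$, $M=v\tilde M$, $N=v\tilde N$ are the coefficients of the first and second fundamental forms. A curve $\gamma$ is a curvature line if $\gamma'$ is a principal vector. Invariants along $\gamma$, for an adapted pair $(\xi,\eta)$ with $\det(\xi f,\eta\eta f,\nu)>0$: $\kappa_\nu=\langle\hat\gamma'',\nu\rangle/|\hat\gamma'|^2$ (limiting normal curvature); $\kappa_t=\frac{\det(\xi f,\eta\eta f,\xi\eta\eta f)}{|\xi f\times\eta\eta f|^2}-\frac{\det(\xi f,\eta\eta f,\xi\xi f)\langle\xi f,\eta\eta f\rangle}{|\xi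 f|^2|\xi f\times\eta\eta f|^2}$ (cuspidal torsion); and, choosing an adapted pair $(\xi,\tilde\eta)$ with $\langle\tilde\eta^2f,\xi f\rangle=\langle\tilde\eta^3f,\xi f\rangle=0$ along $\gamma$ ($\tilde\eta^kf$ is the $k$-fold directional derivative), $r_b=\frac{|\xi f|^2\det(\xi f,\tilde\eta^2f,\tilde\eta^4f)}{|\xi f\times\tilde\eta^2f|^3}$ (bias). *)

theory Defs
  imports "HOL-Analysis.Analysis"
begin

section \<open>Smooth maps, vector fields and partial derivatives\<close>

text \<open>Intended for open sets \<open>S\<close>: all iterated directional derivatives of order up to \<open>k\<close> exist
  and are continuous on \<open>S\<close>.\<close>

primrec Ck_on :: "nat \<Rightarrow> ('a::real_normed_vector \<Rightarrow> 'b::real_normed_vector) \<Rightarrow> 'a set \<Rightarrow> bool" where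
  "Ck_on 0 f S \<longleftrightarrow> continuous_on S f"
| "Ck_on (Suc k) f S \<longleftrightarrow> (\<forall>x\<in>S. f differentiable (at x)) \<and>
     (\<forall>X. Ck_on k (\<lambda>x. frechet_derivative f (at x) X) S)"

definition smooth_on :: "'a set \<Rightarrow> ('a::real_normed_vector \<Rightarrow> 'b::real_normed_vector) \<Rightarrow> bool" where
  "smooth_on S f \<longleftrightarrow> (\<forall>k. Ck_on k f S)"

type_synonym plane = "real \<times> real"

text \<open>A vector field \<open>X\<close> on a subset of the plane is a map into the plane; \<open>dirder X f\<close> is \<open>X f\<close>.\<close>

definition dirder :: "(plane \<Rightarrow> plane) \<Rightarrow> (plane \<Rightarrow> 'b::real_normed_vector) \<Rightarrow> plane \<Rightarrow> 'b" where
  "dirder X f q = frechet_derivative f (at q) (X q)"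

abbreviation pd_u :: "(plane \<Rightarrow> 'b::real_normed_vector) \<Rightarrow> plane \<Rightarrow> 'b" where
  "pd_u \<equiv> dirder (\<lambda>_. (1, 0))"

abbreviation pd_v :: "(plane \<Rightarrow> 'b::real_normed_vector) \<Rightarrow> plane \<Rightarrow> 'b" where
  "pd_v \<equiv> dirder (\<lambda>_. (0, 1))"

abbreviation velocity :: "(real \<Rightarrow> 'b::real_normed_vector) \<Rightarrow> real \<Rightarrow> 'b" where
  "velocity c t \<equiv> vector_derivative c (at t)"

definition det2 :: "plane \<Rightarrow> plane \<Rightarrow> real" where
  "det2 X Y = fst X * snd Y - snd X * fst Y"

definition det3 :: "real^3 \<Rightarrow> real^3 \<Rightarrow> real^3 \<Rightarrow> real" where
  "det3 a b c = det (vector [a, b, c] :: real^3^3)"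

definition parallel :: "plane \<Rightarrow> plane \<Rightarrow> bool" where
  "parallel X Y \<longleftrightarrow> (\<exists>a b. (a \<noteq> 0 \<or> b \<noteq> 0) \<and> a *\<^sub>R X + b *\<^sub>R Y = 0)"


section \<open>Frontals and pure-frontal singular points\<close>

definition unit_normal_on :: "plane set \<Rightarrow> (plane \<Rightarrow> real^3) \<Rightarrow> (plane \<Rightarrow> real^3) \<Rightarrow> bool" where
  "unit_normal_on V f \<nu> \<longleftrightarrow> smooth_on V \<nu> \<and> \<nu> ` V \<subseteq> sphere 0 1 \<and>
     (\<forall>q\<in>V. \<forall>X. frechet_derivative f (at q) X \<bullet> \<nu> q = 0)"

definition frontal :: "plane set \<Rightarrow> (plane \<Rightarrow> real^3) \<Rightarrow> bool" where
  "frontal V f \<longleftrightarrow> open V \<and> smooth_on V f \<and> (\<exists>\<nu>. unit_normal_on V f \<nu>)"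

definition sing_set :: "plane set \<Rightarrow> (plane \<Rightarrow> real^3) \<Rightarrow> plane set" where
  "sing_set V f = {q \<in> V. \<not> inj (frechet_derivative f (at q))}"

definition nondegenerate ::
  "plane set \<Rightarrow> (plane \<Rightarrow> real^3) \<Rightarrow> (plane \<Rightarrow> real^3) \<Rightarrow> plane \<Rightarrow> bool" where
  "nondegenerate V f \<nu> p \<longleftrightarrow> p \<in> sing_set V f \<and>
     frechet_derivative (\<lambda>q. det3 (pd_u f q) (pd_v f q) (\<nu> q)) (at p) \<noteq> (\<lambda>_. 0)"

definition singular_curve ::
  "plane set \<Rightarrow> (plane \<Rightarrow> real^3) \<Rightarrow> plane \<Rightarrow> plane set \<Rightarrow> real \<Rightarrow> (real \<Rightarrow> plane) \<Rightarrow> bool" where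
  "singular_curve V f p U \<epsilon> \<gamma> \<longleftrightarrow> open U \<and> p \<in> U \<and> U \<subseteq> V \<and> 0 < \<epsilon> \<and>
     smooth_on {-\<epsilon><..<\<epsilon>} \<gamma> \<and> (\<forall>t\<in>{-\<epsilon><..<\<epsilon>}. velocity \<gamma> t \<noteq> 0) \<and>
     \<gamma> ` {-\<epsilon><..<\<epsilon>} = sing_set V f \<inter> U \<and> \<gamma> 0 = p"

definition null_vector_field ::
  "plane set \<Rightarrow> (plane \<Rightarrow> real^3) \<Rightarrow> plane set \<Rightarrow> (plane \<Rightarrow> plane) \<Rightarrow> bool" where
  "null_vector_field V f U \<eta> \<longleftrightarrow> smooth_on U \<eta> \<and> (\<forall>q\<in>U. \<eta> q \<noteq> 0) \<and>
     (\<forall>q\<in>sing_set V f \<inter> U. dirder \<eta> f q = 0)"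

text \<open>In the next two definitions the null vector field is existentially quantified; at a
  non-degenerate singular point the conditions do not depend on its choice.\<close>

definition first_kind ::
  "plane set \<Rightarrow> (plane \<Rightarrow> real^3) \<Rightarrow> (plane \<Rightarrow> real^3) \<Rightarrow> plane \<Rightarrow>
   plane set \<Rightarrow> real \<Rightarrow> (real \<Rightarrow> plane) \<Rightarrow> bool" where
  "first_kind V f \<nu> p U \<epsilon> \<gamma> \<longleftrightarrow> nondegenerate V f \<nu> p \<and> singular_curve V f p U \<epsilon> \<gamma> \<and>
     (\<exists>\<eta>. null_vector_field V f U \<eta> \<and> det2 (velocity \<gamma> 0) (\<eta> p) \<noteq> 0)"

definition psi ::
  "(plane \<Rightarrow> real^3) \<Rightarrow> (plane \<Rightarrow> real^3) \<Rightarrow> (real \<Rightarrow> plane) \<Rightarrow> (plane \<Rightarrow> plane) \<Rightarrow> real \<Rightarrow> real" where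
  "psi f \<nu> \<gamma> \<eta> t = det3 (velocity (f \<circ> \<gamma>) t) (\<nu> (\<gamma> t)) (dirder \<eta> \<nu> (\<gamma> t))"

definition pure_frontal ::
  "plane set \<Rightarrow> (plane \<Rightarrow> real^3) \<Rightarrow> (plane \<Rightarrow> real^3) \<Rightarrow> plane \<Rightarrow>
   plane set \<Rightarrow> real \<Rightarrow> (real \<Rightarrow> plane) \<Rightarrow> bool" where
  "pure_frontal V f \<nu> p U \<epsilon> \<gamma> \<longleftrightarrow> first_kind V f \<nu> p U \<epsilon> \<gamma> \<and>
     (\<exists>\<eta>. null_vector_field V f U \<eta> \<and> (\<forall>t\<in>{-\<epsilon><..<\<epsilon>}. psi f \<nu> \<gamma> \<eta> t = 0))"


section \<open>Adapted pairs and adapted coordinates\<close>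

definition adapted_pair ::
  "plane set \<Rightarrow> (plane \<Rightarrow> real^3) \<Rightarrow> plane set \<Rightarrow> real \<Rightarrow> (real \<Rightarrow> plane) \<Rightarrow>
   (plane \<Rightarrow> plane) \<Rightarrow> (plane \<Rightarrow> plane) \<Rightarrow> bool" where
  "adapted_pair V f U \<epsilon> \<gamma> \<xi> \<eta> \<longleftrightarrow> smooth_on U \<xi> \<and> null_vector_field V f U \<eta> \<and>
     (\<forall>q\<in>U. det2 (\<xi> q) (\<eta> q) > 0) \<and>
     (\<forall>t\<in>{-\<epsilon><..<\<epsilon>}. \<exists>c. \<xi> (\<gamma> t) = c *\<^sub>R velocity \<gamma> t)"

text \<open>A coordinate system \<open>(U; u, v)\<close> is given by the parametrization \<open>\<phi> : W \<rightarrow> U\<close> together with the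
  chart \<open>\<theta> = (u, v) : U \<rightarrow> W\<close> inverse to it.\<close>

definition coordinate_system ::
  "plane set \<Rightarrow> plane set \<Rightarrow> (plane \<Rightarrow> plane) \<Rightarrow> (plane \<Rightarrow> plane) \<Rightarrow> bool" where
  "coordinate_system U W \<phi> \<theta> \<longleftrightarrow> open W \<and> open U \<and> smooth_on W \<phi> \<and> smooth_on U \<theta> \<and>
     \<phi> ` W = U \<and> (\<forall>w\<in>W. \<theta> (\<phi> w) = w)"

text \<open>\<open>coord_field \<phi> \<theta> (1, 0)\<close> and \<open>coord_field \<phi> \<theta> (0, 1)\<close> are the vector fields
  \<open>\<partial>\<^sub>u\<close> and \<open>\<partial>\<^sub>v\<close> on \<open>U\<close>.\<close>

definition coord_field :: "(plane \<Rightarrow> plane) \<Rightarrow> (plane \<Rightarrow> plane) \<Rightarrow> plane \<Rightarrow> plane \<Rightarrow> plane" where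
  "coord_field \<phi> \<theta> e q = frechet_derivative \<phi> (at (\<theta> q)) e"

definition adapted_coordinates ::
  "plane set \<Rightarrow> (plane \<Rightarrow> real^3) \<Rightarrow> plane set \<Rightarrow> real \<Rightarrow> (real \<Rightarrow> plane) \<Rightarrow>
   plane set \<Rightarrow> (plane \<Rightarrow> plane) \<Rightarrow> (plane \<Rightarrow> plane) \<Rightarrow> bool" where
  "adapted_coordinates V f U \<epsilon> \<gamma> W \<phi> \<theta> \<longleftrightarrow> coordinate_system U W \<phi> \<theta> \<and>
     \<phi> ` {w\<in>W. snd w = 0} = \<gamma> ` {-\<epsilon><..<\<epsilon>} \<and>
     adapted_pair V f U \<epsilon> \<gamma> (coord_field \<phi> \<theta> (1, 0)) (coord_field \<phi> \<theta> (0, 1))"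

definition orthogonal_adapted_coordinates ::
  "plane set \<Rightarrow> (plane \<Rightarrow> real^3) \<Rightarrow> plane set \<Rightarrow> real \<Rightarrow> (real \<Rightarrow> plane) \<Rightarrow>
   plane set \<Rightarrow> (plane \<Rightarrow> plane) \<Rightarrow> (plane \<Rightarrow> plane) \<Rightarrow> bool" where
  "orthogonal_adapted_coordinates V f U \<epsilon> \<gamma> W \<phi> \<theta> \<longleftrightarrow> adapted_coordinates V f U \<epsilon> \<gamma> W \<phi> \<theta> \<and>
     (\<forall>w\<in>W. snd w = 0 \<longrightarrow>
        norm (pd_u (f \<circ> \<phi>) w) = 1 \<and> norm (pd_v (pd_v (f \<circ> \<phi>)) w) = 1 \<and>
        pd_u (f \<circ> \<phi>) w \<bullet> pd_v (pd_v (f \<circ> \<phi>)) w = 0)"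


section \<open>Fundamental forms, curvatures and principal vectors\<close>

definition form_E :: "(plane \<Rightarrow> real^3) \<Rightarrow> plane \<Rightarrow> real" where
  "form_E f q = pd_u f q \<bullet> pd_u f q"

definition form_F :: "(plane \<Rightarrow> real^3) \<Rightarrow> plane \<Rightarrow> real" where
  "form_F f q = pd_u f q \<bullet> pd_v f q"

definition form_G :: "(plane \<Rightarrow> real^3) \<Rightarrow> plane \<Rightarrow> real" where
  "form_G f q = pd_v f q \<bullet> pd_v f q"

definition form_L :: "(plane \<Rightarrow> real^3) \<Rightarrow> (plane \<Rightarrow> real^3) \<Rightarrow> plane \<Rightarrow> real" where
  "form_L f \<nu> q = - (pd_u f q \<bullet> pd_u \<nu> q)"

definition form_M :: "(plane \<Rightarrow> real^3) \<Rightarrow> (plane \<Rightarrow> real^3) \<Rightarrow> plane \<Rightarrow> real" where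
  "form_M f \<nu> q = - (pd_v f q \<bullet> pd_u \<nu> q)"

definition form_N :: "(plane \<Rightarrow> real^3) \<Rightarrow> (plane \<Rightarrow> real^3) \<Rightarrow> plane \<Rightarrow> real" where
  "form_N f \<nu> q = - (pd_v f q \<bullet> pd_v \<nu> q)"

text \<open>The value at a singular point of the (unique) continuous extension of a function on the
  regular set; arbitrary if the limit does not exist.\<close>

definition extend_to_singular ::
  "plane set \<Rightarrow> (plane \<Rightarrow> real^3) \<Rightarrow> (plane \<Rightarrow> real) \<Rightarrow> plane \<Rightarrow> real" where
  "extend_to_singular V f k q =
     (if q \<in> sing_set V f then Lim (at q within V - sing_set V f) k else k q)"

definition gauss_curv ::
  "plane set \<Rightarrow> (plane \<Rightarrow> real^3) \<Rightarrow> (plane \<Rightarrow> real^3) \<Rightarrow> plane \<Rightarrow> real" where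
  "gauss_curv V f \<nu> = extend_to_singular V f
     (\<lambda>q. (form_L f \<nu> q * form_N f \<nu> q - (form_M f \<nu> q)\<^sup>2) /
          (form_E f q * form_G f q - (form_F f q)\<^sup>2))"

definition mean_curv ::
  "plane set \<Rightarrow> (plane \<Rightarrow> real^3) \<Rightarrow> (plane \<Rightarrow> real^3) \<Rightarrow> plane \<Rightarrow> real" where
  "mean_curv V f \<nu> = extend_to_singular V f
     (\<lambda>q. (form_E f q * form_N f \<nu> q - 2 * form_F f q * form_M f \<nu> q + form_G f q * form_L f \<nu> q) /
          (2 * (form_E f q * form_G f q - (form_F f q)\<^sup>2)))"

definition kappa1 ::
  "plane set \<Rightarrow> (plane \<Rightarrow> real^3) \<Rightarrow> (plane \<Rightarrow> real^3) \<Rightarrow> plane \<Rightarrow> real" where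
  "kappa1 V f \<nu> q = mean_curv V f \<nu> q + sqrt ((mean_curv V f \<nu> q)\<^sup>2 - gauss_curv V f \<nu> q)"

definition kappa2 ::
  "plane set \<Rightarrow> (plane \<Rightarrow> real^3) \<Rightarrow> (plane \<Rightarrow> real^3) \<Rightarrow> plane \<Rightarrow> real" where
  "kappa2 V f \<nu> q = mean_curv V f \<nu> q - sqrt ((mean_curv V f \<nu> q)\<^sup>2 - gauss_curv V f \<nu> q)"

definition umbilic ::
  "plane set \<Rightarrow> (plane \<Rightarrow> real^3) \<Rightarrow> (plane \<Rightarrow> real^3) \<Rightarrow> plane \<Rightarrow> bool" where
  "umbilic V f \<nu> q \<longleftrightarrow> (mean_curv V f \<nu> q)\<^sup>2 - gauss_curv V f \<nu> q = 0"

text \<open>The condition \<open>\<kappa> I X = II X\<close> is invariant under changes of coordinates, so it may be written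
  in the standard coordinates of the plane.\<close>

definition principal_vector ::
  "(plane \<Rightarrow> real^3) \<Rightarrow> (plane \<Rightarrow> real^3) \<Rightarrow> real \<Rightarrow> plane \<Rightarrow> plane \<Rightarrow> bool" where
  "principal_vector f \<nu> \<kappa> q X \<longleftrightarrow>
     \<kappa> * (form_E f q * fst X + form_F f q * snd X) = form_L f \<nu> q * fst X + form_M f \<nu> q * snd X \<and>
     \<kappa> * (form_F f q * fst X + form_G f q * snd X) = form_M f \<nu> q * fst X + form_N f \<nu> q * snd X"

definition curvature_line ::
  "plane set \<Rightarrow> (plane \<Rightarrow> real^3) \<Rightarrow> (plane \<Rightarrow> real^3) \<Rightarrow> real \<Rightarrow> (real \<Rightarrow> plane) \<Rightarrow> bool" where
  "curvature_line V f \<nu> \<epsilon> \<gamma> \<longleftrightarrow> (\<forall>t\<in>{-\<epsilon><..<\<epsilon>}.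
     \<exists>\<kappa>\<in>{kappa1 V f \<nu> (\<gamma> t), kappa2 V f \<nu> (\<gamma> t)}. principal_vector f \<nu> \<kappa> (\<gamma> t) (velocity \<gamma> t))"

text \<open>\<^const>\<open>kappa1\<close> and \<^const>\<open>kappa2\<close> are already extended to the singular set, so this formula also
  yields the extension of the principal vectors across the singular curve.
  The field is \<open>- v (M~ - \<kappa> F~) \<partial>\<^sub>u + (L~ - \<kappa> E~) \<partial>\<^sub>v\<close> in
  components, for a surface \<open>g\<close> with unit normal \<open>n\<close> in adapted coordinates and \<open>g\<^sub>v = v h\<close>; here \<open>E~ = E\<close> and \<open>L~ = L\<close>.\<close>

definition principal_field ::
  "(plane \<Rightarrow> real^3) \<Rightarrow> (plane \<Rightarrow> real^3) \<Rightarrow> (plane \<Rightarrow> real^3) \<Rightarrow> (plane \<Rightarrow> real) \<Rightarrow> plane \<Rightarrow> plane" where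
  "principal_field g n h \<kappa> w =
     (let E = pd_u g w \<bullet> pd_u g w; F = pd_u g w \<bullet> h w;
          L = - (pd_u g w \<bullet> pd_u n w); M = - (h w \<bullet> pd_u n w)
      in (- snd w * (M - \<kappa> w * F), L - \<kappa> w * E))"


section \<open>Invariants along the singular curve\<close>

definition limiting_normal_curvature ::
  "(plane \<Rightarrow> real^3) \<Rightarrow> (plane \<Rightarrow> real^3) \<Rightarrow> (real \<Rightarrow> plane) \<Rightarrow> real \<Rightarrow> real" where
  "limiting_normal_curvature f \<nu> \<gamma> t =
     (velocity (velocity (f \<circ> \<gamma>)) t \<bullet> \<nu> (\<gamma> t)) / (norm (velocity (f \<circ> \<gamma>) t))\<^sup>2"

definition cuspidal_torsion ::
  "(plane \<Rightarrow> real^3) \<Rightarrow> (plane \<Rightarrow> plane) \<Rightarrow> (plane \<Rightarrow> plane) \<Rightarrow> plane \<Rightarrow> real" where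
  "cuspidal_torsion f \<xi> \<eta> q =
     (let \<xi>f = dirder \<xi> f q; \<eta>\<eta>f = dirder \<eta> (dirder \<eta> f) q;
          \<xi>\<eta>\<eta>f = dirder \<xi> (dirder \<eta> (dirder \<eta> f)) q; \<xi>\<xi>f = dirder \<xi> (dirder \<xi> f) q
      in det3 \<xi>f \<eta>\<eta>f \<xi>\<eta>\<eta>f / (norm (cross3 \<xi>f \<eta>\<eta>f))\<^sup>2 -
         det3 \<xi>f \<eta>\<eta>f \<xi>\<xi>f * (\<xi>f \<bullet> \<eta>\<eta>f) / ((norm \<xi>f)\<^sup>2 * (norm (cross3 \<xi>f \<eta>\<eta>f))\<^sup>2))"

definition bias ::
  "(plane \<Rightarrow> real^3) \<Rightarrow> (plane \<Rightarrow> plane) \<Rightarrow> (plane \<Rightarrow> plane) \<Rightarrow> plane \<Rightarrow> real" where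
  "bias f \<xi> \<eta> q =
     (let \<xi>f = dirder \<xi> f q; \<eta>2f = (dirder \<eta> ^^ 2) f q; \<eta>4f = (dirder \<eta> ^^ 4) f q
      in (norm \<xi>f)\<^sup>2 * det3 \<xi>f \<eta>2f \<eta>4f / (norm (cross3 \<xi>f \<eta>2f))^3)"

text \<open>The condition on an adapted pair under which \<^const>\<open>bias\<close> is evaluated.\<close>

definition bias_normalized ::
  "(plane \<Rightarrow> real^3) \<Rightarrow> real \<Rightarrow> (real \<Rightarrow> plane) \<Rightarrow> (plane \<Rightarrow> plane) \<Rightarrow> (plane \<Rightarrow> plane) \<Rightarrow> bool" where
  "bias_normalized f \<epsilon> \<gamma> \<xi> \<eta> \<longleftrightarrow> (\<forall>t\<in>{-\<epsilon><..<\<epsilon>}.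
     (dirder \<eta> ^^ 2) f (\<gamma> t) \<bullet> dirder \<xi> f (\<gamma> t) = 0 \<and>
     (dirder \<eta> ^^ 3) f (\<gamma> t) \<bullet> dirder \<xi> f (\<gamma> t) = 0)"

end

theory Submission
  imports Defs
begin

text \<open>
  In orthogonal adapted coordinates the surface is \<open>g = f \<circ> \<phi>\<close> with normal \<open>n = \<nu> \<circ> \<phi>\<close>, the singular
  curve is the axis \<open>v = 0\<close>, and \<open>g\<^sub>v = v h\<close>, where \<open>(g\<^sub>u, h, n)\<close> is a positive orthonormal frame on
  the axis. With the reduced coefficients \<open>E = g\<^sub>u \<bullet> g\<^sub>u\<close>, \<open>F = g\<^sub>u \<bullet> h\<close>, \<open>G = h \<bullet> h\<close>,
  \<open>L = - g\<^sub>u \<bullet> n\<^sub>u\<close>, \<open>M = - h \<bullet> n\<^sub>u\<close>, \<open>N = - h \<bullet> n\<^sub>v\<close>, the fundamental forms are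
  \<open>(E, v F, v\<^sup>2 G)\<close> and \<open>(L, v M, v N)\<close>.

  Purity means that \<open>N = 0\<close> on the axis (lemma \<open>N_axis\<close>). By the division lemma
  \<open>smooth_on_axis_quotient\<close>, \<open>N = v N'\<close> with \<open>N'\<close> smooth. The factor \<open>v\<^sup>2\<close> then cancels from
  the formulas for the Gaussian and mean curvatures, so these extend smoothly, and the principal
  curvatures are the roots \<open>\<kappa>\<close> of
  \<open>(\<kappa> E - L) (\<kappa> G - N') = (M - \<kappa> F)\<^sup>2\<close> (lemma \<open>characteristic_iff\<close>). At a point that is not umbilic
  the discriminant is positive, hence both roots, and with them both principal fields
  \<open>(- v (M - \<kappa> F), L - \<kappa> E)\<close>, are smooth nearby.

  On the axis \<open>E = G = 1\<close> and \<open>F = 0\<close>, so the equation becomes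
  \<open>(\<kappa> - L) (\<kappa> - N') = M\<^sup>2\<close>; in particular \<open>L\<close> is a principal curvature if and only if \<open>M = 0\<close>.
  On the other hand the cuspidal torsion equals \<open>M\<close> on the axis, whatever adapted pair computes it
  (lemma \<open>cuspidal_torsion_chart\<close>). The three assertions follow.

  (1) If \<open>M \<noteq> 0\<close> at the point, then \<open>\<kappa> \<noteq> L\<close>, and both fields equal the nonzero vectors
  \<open>(0, L - \<kappa>)\<close>, which point in the null direction.

  (2) If \<open>M = 0\<close> on the axis, then \<open>M\<close> and \<open>F\<close> are divisible by \<open>v\<close>, say \<open>M = v M'\<close> and
  \<open>F = v F'\<close>. One principal curvature is \<open>L\<close> at the point, and its field vanishes there, but
  the field is parallel to \<open>(N' - \<kappa> G, - (M' - \<kappa> F'))\<close>, which is transverse to the null direction.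
  The field of the other curvature is nonzero and null at the point (lemma \<open>principal_frame\<close>).

  (3) A tangent vector of the singular curve is a multiple of \<open>\<partial>\<^sub>u\<close>, and on the axis it is principal
  for \<open>\<kappa>\<close> exactly when \<open>\<kappa> = L\<close>. So the singular curve is a curvature line if and only if
  \<open>M\<close> vanishes along it (lemma \<open>curvature_line_iff\<close>).
\<close>

section \<open>Calculus of smooth maps\<close>

lemma has_derivative_frechet:
  assumes "smooth_on S f" "x \<in> S"
  shows "(f has_derivative frechet_derivative f (at x)) (at x)"
proof -
  have "Ck_on (Suc 0) f S" using assms(1) unfolding smooth_on_def by blast
  then show ?thesis using assms(2) frechet_derivative_works by auto
qed

lemma smooth_on_imp_differentiable:
  "smooth_on S f \<Longrightarrow> x \<in> S \<Longrightarrow> f differentiable (at x)"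
  using has_derivative_frechet differentiable_def by blast

lemma smooth_on_imp_continuous_on: "smooth_on S f \<Longrightarrow> continuous_on S f"
  unfolding smooth_on_def by (metis Ck_on.simps(1))

lemma smooth_on_frechet:
  "smooth_on S f \<Longrightarrow> smooth_on S (\<lambda>x. frechet_derivative f (at x) X)"
  unfolding smooth_on_def by (metis Ck_on.simps(2))

lemma Ck_on_mono_order:
  assumes "Ck_on (Suc k) f S"
  shows "Ck_on k f S"
  using assms
proof (induction k arbitrary: f)
  case 0
  then have "f differentiable_on S" by (simp add: differentiable_on_def differentiable_at_withinI)
  then show ?case by (simp add: differentiable_imp_continuous_on)
next
  case (Suc k)
  then show ?case by (metis Ck_on.simps(2))
qed

lemma Ck_on_cong:
  assumes "open S" "\<And>x. x \<in> S \<Longrightarrow> f x = g x" "Ck_on k f S"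
  shows "Ck_on k g S"
  using assms(2,3)
proof (induction k arbitrary: f g)
  case 0
  then show ?case by (simp cong: continuous_on_cong)
next
  case (Suc k)
  have d: "(g has_derivative frechet_derivative f (at x)) (at x)" if "x \<in> S" for x
    using that Suc.prems assms(1)
    by (auto intro: has_derivative_transform_within_open simp: frechet_derivative_works)
  have e: "frechet_derivative f (at x) = frechet_derivative g (at x)" if "x \<in> S" for x
    using frechet_derivative_at[OF d[OF that]] .
  show ?case
    using Suc.prems(2) d Suc.IH[of "\<lambda>x. frechet_derivative f (at x) X"
        "\<lambda>x. frechet_derivative g (at x) X" for X] e
    by (auto simp: differentiable_def)
qed

lemma smooth_on_cong:
  "open S \<Longrightarrow> smooth_on S f \<Longrightarrow> (\<And>x. x \<in> S \<Longrightarrow> f x = g x) \<Longrightarrow> smooth_on S g"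
  unfolding smooth_on_def using Ck_on_cong by metis

lemma Ck_on_subset: "Ck_on k f S \<Longrightarrow> T \<subseteq> S \<Longrightarrow> Ck_on k f T"
  by (induction k arbitrary: f) (auto intro: continuous_on_subset)

lemma smooth_on_subset: "smooth_on S f \<Longrightarrow> T \<subseteq> S \<Longrightarrow> smooth_on T f"
  unfolding smooth_on_def using Ck_on_subset by blast

lemma Ck_on_local:
  assumes "\<And>x. x \<in> S \<Longrightarrow> \<exists>T. open T \<and> x \<in> T \<and> Ck_on k f T"
  shows "Ck_on k f S"
  using assms
proof (induction k arbitrary: f)
  case 0
  show ?case unfolding Ck_on.simps
  proof (rule continuous_at_imp_continuous_on, rule ballI)
    fix x assume "x \<in> S"
    then obtain T where "open T" "x \<in> T" "continuous_on T f" using 0 by auto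
    then show "isCont f x" using continuous_on_eq_continuous_at by blast
  qed
next
  case (Suc k)
  then show ?case by simp meson
qed

lemma smooth_on_local:
  assumes "\<And>x. x \<in> S \<Longrightarrow> \<exists>T. open T \<and> x \<in> T \<and> smooth_on T f"
  shows "smooth_on S f"
  unfolding smooth_on_def using assms smooth_on_def by (metis Ck_on_local)

lemma Ck_on_const: "Ck_on k (\<lambda>x. c) S"
  by (induction k arbitrary: c) auto

lemma smooth_on_const: "smooth_on S (\<lambda>x. c)"
  unfolding smooth_on_def using Ck_on_const by blast

lemma smooth_on_bounded_linear:
  assumes "bounded_linear L"
  shows "smooth_on S L"
proof -
  have "Ck_on k L S" for k
    using assms
    by (cases k) (auto simp: Ck_on_const bounded_linear_imp_differentiable linear_continuous_on
        simp flip: frechet_derivative_at[OF bounded_linear_imp_has_derivative[OF assms]])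
  then show ?thesis unfolding smooth_on_def by blast
qed

lemma Ck_on_add:
  assumes "open S" "Ck_on k f S" "Ck_on k g S"
  shows "Ck_on k (\<lambda>x. f x + g x) S"
  using assms(2,3)
proof (induction k arbitrary: f g)
  case 0 then show ?case by (auto intro: continuous_on_add)
next
  case (Suc k)
  have d: "((\<lambda>x. f x + g x) has_derivative
      (\<lambda>X. frechet_derivative f (at x) X + frechet_derivative g (at x) X)) (at x)"
    if "x \<in> S" for x
    using that Suc.prems by (auto intro!: derivative_eq_intros simp: frechet_derivative_works)
  show ?case unfolding Ck_on.simps
  proof (intro conjI ballI allI)
    fix x assume "x \<in> S" then show "(\<lambda>x. f x + g x) differentiable at x"
      using d differentiable_def by blast
  next
    fix X
    have "Ck_on k (\<lambda>x. frechet_derivative f (at x) X + frechet_derivative g (at x) X) S"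
      using Suc by auto
    then show "Ck_on k (\<lambda>x. frechet_derivative (\<lambda>x. f x + g x) (at x) X) S"
      by (rule Ck_on_cong[OF assms(1), rotated]) (simp add: frechet_derivative_at[OF d, symmetric])
  qed
qed

lemma smooth_on_add:
  "open S \<Longrightarrow> smooth_on S f \<Longrightarrow> smooth_on S g \<Longrightarrow> smooth_on S (\<lambda>x. f x + g x)"
  unfolding smooth_on_def using Ck_on_add by blast

text \<open>A directional derivative of a product is a sum of two products whose factors are differentiable
  once less, so the induction on the order runs over all pairs of factors at once.\<close>

lemma (in bounded_bilinear) Ck_on_bilinear:
  assumes "open S" "Ck_on k f S" "Ck_on k g S"
  shows "Ck_on k (\<lambda>x. prod (f x) (g x)) S"
  using assms(2,3)
proof (induction k arbitrary: f g)
  case 0 then show ?case by (auto intro: continuous_on)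
next
  case (Suc k)
  have d: "((\<lambda>x. prod (f x) (g x)) has_derivative (\<lambda>X. prod (f x) (frechet_derivative g (at x) X) +
      prod (frechet_derivative f (at x) X) (g x))) (at x)" if "x \<in> S" for x
    using that Suc.prems by (auto intro!: FDERIV simp: frechet_derivative_works)
  show ?case unfolding Ck_on.simps
  proof (intro conjI ballI allI)
    fix x assume "x \<in> S" then show "(\<lambda>x. prod (f x) (g x)) differentiable at x"
      using d differentiable_def by blast
  next
    fix X
    have "Ck_on k (\<lambda>x. prod (f x) (frechet_derivative g (at x) X) +
        prod (frechet_derivative f (at x) X) (g x)) S"
      using Suc.prems Suc.prems[THEN Ck_on_mono_order]
      by (intro Ck_on_add[OF assms(1)] Suc.IH) auto
    then show "Ck_on k (\<lambda>x. frechet_derivative (\<lambda>x. prod (f x) (g x)) (at x) X) S"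
      by (rule Ck_on_cong[OF assms(1), rotated]) (simp add: frechet_derivative_at[OF d, symmetric])
  qed
qed

lemma (in bounded_bilinear) smooth_on_bilinear:
  "open S \<Longrightarrow> smooth_on S f \<Longrightarrow> smooth_on S g \<Longrightarrow> smooth_on S (\<lambda>x. prod (f x) (g x))"
  unfolding smooth_on_def using Ck_on_bilinear by blast

lemmas smooth_on_mult =
  bounded_bilinear.smooth_on_bilinear[OF bounded_bilinear_mult]
lemmas smooth_on_scaleR =
  bounded_bilinear.smooth_on_bilinear[OF bounded_bilinear_scaleR]
lemmas smooth_on_inner =
  bounded_bilinear.smooth_on_bilinear[OF bounded_bilinear_inner]

lemma smooth_on_uminus: "open S \<Longrightarrow> smooth_on S f \<Longrightarrow> smooth_on S (\<lambda>x. - f x)"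
  using smooth_on_scaleR[of S "\<lambda>x. - 1" f] smooth_on_const by auto

lemma smooth_on_diff:
  "open S \<Longrightarrow> smooth_on S f \<Longrightarrow> smooth_on S g \<Longrightarrow> smooth_on S (\<lambda>x. f x - g x)"
  using smooth_on_add[of S f "\<lambda>x. - g x"] smooth_on_uminus by auto

text \<open>Expanding the outer derivative in a basis makes the chain rule a sum of products of a derivative
  of \<open>g\<close> with some \<open>\<partial>\<^sub>b f \<circ> g\<close>, and the induction hypothesis covers the latter because \<open>f\<close> is
  arbitrary in it.\<close>

lemma Ck_on_compose:
  fixes f :: "'b::euclidean_space \<Rightarrow> 'c::real_normed_vector"
    and g :: "'a::real_normed_vector \<Rightarrow> 'b"
  assumes "open S" "open T" "g ` S \<subseteq> T" "Ck_on k f T" "Ck_on k g S"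
  shows "Ck_on k (\<lambda>x. f (g x)) S"
  using assms(4,5)
proof (induction k arbitrary: f)
  case 0 then show ?case using assms(3) by (auto intro: continuous_on_compose2)
next
  case (Suc k)
  let ?D = "\<lambda>x X. \<Sum>b\<in>Basis. (frechet_derivative g (at x) X \<bullet> b) *\<^sub>R frechet_derivative f (at (g x)) b"
  have d: "((\<lambda>x. f (g x)) has_derivative ?D x) (at x)" if "x \<in> S" for x
  proof -
    have f: "(f has_derivative frechet_derivative f (at (g x))) (at (g x))"
      using Suc.prems assms(3) that frechet_derivative_works by auto
    have "((\<lambda>x. f (g x)) has_derivative
        (\<lambda>X. frechet_derivative f (at (g x)) (frechet_derivative g (at x) X))) (at x)"
      using Suc.prems that
      by (intro has_derivative_compose[of g _ _ _ f] f) (auto simp: frechet_derivative_works[symmetric])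
    moreover have "frechet_derivative f (at (g x)) Y
        = (\<Sum>b\<in>Basis. (Y \<bullet> b) *\<^sub>R frechet_derivative f (at (g x)) b)" for Y
    proof -
      have "frechet_derivative f (at (g x)) Y
          = frechet_derivative f (at (g x)) (\<Sum>b\<in>Basis. (Y \<bullet> b) *\<^sub>R b)"
        by (simp add: euclidean_representation)
      then show ?thesis
        using has_derivative_linear[OF f] by (simp add: linear_sum linear_scale)
    qed
    ultimately show ?thesis by (blast intro: has_derivative_eq_rhs)
  qed
  show ?case unfolding Ck_on.simps
  proof (intro conjI ballI allI)
    fix x assume "x \<in> S" then show "(\<lambda>x. f (g x)) differentiable at x"
      using d differentiable_def by blast
  next
    fix X
    have g: "Ck_on k g S" using Suc.prems Ck_on_mono_order by blast
    have s: "Ck_on k (\<lambda>x. \<Sum>b\<in>I. (frechet_derivative g (at x) X \<bullet> b)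
        *\<^sub>R frechet_derivative f (at (g x)) b) S" if "finite I" for I
      using that
    proof (induction I)
      case empty show ?case by (simp add: Ck_on_const)
    next
      case (insert b I)
      have "Ck_on k (\<lambda>x. (frechet_derivative g (at x) X \<bullet> b) *\<^sub>R frechet_derivative f (at (g x)) b) S"
        using Suc.prems g
        by (intro bounded_bilinear.Ck_on_bilinear[OF bounded_bilinear_scaleR]
            bounded_bilinear.Ck_on_bilinear[OF bounded_bilinear_inner] Ck_on_const assms(1)
            Suc.IH[of "\<lambda>y. frechet_derivative f (at y) b"]) auto
      then show ?case using insert by (auto intro: Ck_on_add[OF assms(1)])
    qed
    show "Ck_on k (\<lambda>x. frechet_derivative (\<lambda>x. f (g x)) (at x) X) S"
      by (rule Ck_on_cong[OF assms(1) _ s[OF finite_Basis]])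
        (simp add: frechet_derivative_at[OF d, symmetric])
  qed
qed

lemma smooth_on_compose:
  fixes f :: "'b::euclidean_space \<Rightarrow> 'c::real_normed_vector"
  assumes "open S" "open T" "g ` S \<subseteq> T" "smooth_on T f" "smooth_on S g"
  shows "smooth_on S (f \<circ> g)"
  using assms Ck_on_compose unfolding smooth_on_def comp_def by blast

lemma smooth_on_inverse:
  fixes f :: "'a::real_normed_vector \<Rightarrow> real"
  assumes "open S" "smooth_on S f" "\<And>x. x \<in> S \<Longrightarrow> f x \<noteq> 0"
  shows "smooth_on S (\<lambda>x. inverse (f x))"
proof -
  have "Ck_on k (\<lambda>x. inverse (f x)) S" for k
  proof (induction k)
    case 0 then show ?case
      using smooth_on_imp_continuous_on[OF assms(2)] assms(3) by (auto intro: continuous_intros)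
  next
    case (Suc k)
    have d: "((\<lambda>x. inverse (f x)) has_derivative
        (\<lambda>X. - (inverse (f x) * (frechet_derivative f (at x) X * inverse (f x))))) (at x)"
      if "x \<in> S" for x
      using Deriv.has_derivative_inverse[OF assms(3)[OF that] has_derivative_frechet[OF assms(2) that]]
      by (simp add: mult.assoc)
    show ?case unfolding Ck_on.simps
    proof (intro conjI ballI allI)
      fix x assume "x \<in> S" then show "(\<lambda>x. inverse (f x)) differentiable at x"
        using d differentiable_def by blast
    next
      fix X
      have f': "Ck_on k (\<lambda>x. frechet_derivative f (at x) X) S"
        using smooth_on_frechet[OF assms(2)] smooth_on_def by blast
      have "Ck_on k (\<lambda>x. (- 1) * (inverse (f x) * (frechet_derivative f (at x) X * inverse (f x)))) S"
        by (intro bounded_bilinear.Ck_on_bilinear[OF bounded_bilinear_mult] Ck_on_const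
            assms(1) f' Suc)
      then show "Ck_on k (\<lambda>x. frechet_derivative (\<lambda>x. inverse (f x)) (at x) X) S"
        by (rule Ck_on_cong[OF assms(1), rotated])
          (simp add: frechet_derivative_at[OF d, symmetric])
    qed
  qed
  then show ?thesis unfolding smooth_on_def by blast
qed

lemma smooth_on_divide:
  fixes f g :: "'a::real_normed_vector \<Rightarrow> real"
  shows "open S \<Longrightarrow> smooth_on S f \<Longrightarrow> smooth_on S g \<Longrightarrow> (\<And>x. x \<in> S \<Longrightarrow> g x \<noteq> 0)
    \<Longrightarrow> smooth_on S (\<lambda>x. f x / g x)"
  unfolding divide_inverse by (intro smooth_on_mult smooth_on_inverse)

text \<open>The induction is on \<open>1 / sqrt f\<close>: its derivatives are polynomials in itself and a derivative
  of \<open>f\<close>, whereas differentiating \<open>sqrt f\<close> produces a quotient.\<close>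

lemma smooth_on_sqrt:
  fixes f :: "'a::real_normed_vector \<Rightarrow> real"
  assumes "open S" "smooth_on S f" "\<And>x. x \<in> S \<Longrightarrow> f x > 0"
  shows "smooth_on S (\<lambda>x. sqrt (f x))"
proof -
  have "Ck_on k (\<lambda>x. inverse (sqrt (f x))) S" for k
  proof (induction k)
    case 0 then show ?case
      using smooth_on_imp_continuous_on[OF assms(2)] assms(3)
      by (force intro: continuous_intros)
  next
    case (Suc k)
    have d: "((\<lambda>x. inverse (sqrt (f x))) has_derivative
        (\<lambda>X. (- 1 / 2) * (inverse (sqrt (f x)) * (inverse (sqrt (f x)) *
          (inverse (sqrt (f x)) * frechet_derivative f (at x) X))))) (at x)"
      if "x \<in> S" for x
      using assms(3)[OF that]
      by (auto intro!: derivative_eq_intros has_derivative_frechet[OF assms(2) that]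
          simp: field_simps)
    show ?case unfolding Ck_on.simps
    proof (intro conjI ballI allI)
      fix x assume "x \<in> S" then show "(\<lambda>x. inverse (sqrt (f x))) differentiable at x"
        using d differentiable_def by blast
    next
      fix X
      have f': "Ck_on k (\<lambda>x. frechet_derivative f (at x) X) S"
        using smooth_on_frechet[OF assms(2)] smooth_on_def by blast
      have "Ck_on k (\<lambda>x. (- 1 / 2) * (inverse (sqrt (f x)) * (inverse (sqrt (f x)) *
          (inverse (sqrt (f x)) * frechet_derivative f (at x) X)))) S"
        by (intro bounded_bilinear.Ck_on_bilinear[OF bounded_bilinear_mult] Ck_on_const
            assms(1) f' Suc)
      then show "Ck_on k (\<lambda>x. frechet_derivative (\<lambda>x. inverse (sqrt (f x))) (at x) X) S"
        by (rule Ck_on_cong[OF assms(1), rotated])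
          (simp add: frechet_derivative_at[OF d, symmetric])
    qed
  qed
  then have "smooth_on S (\<lambda>x. inverse (sqrt (f x)))" unfolding smooth_on_def by blast
  then have "smooth_on S (\<lambda>x. f x * inverse (sqrt (f x)))" by (intro smooth_on_mult assms)
  then show ?thesis
    by (rule smooth_on_cong[OF assms(1)])
      (use assms(3) in \<open>simp add: real_div_sqrt less_imp_le flip: divide_inverse\<close>)
qed

lemma smooth_on_Pair:
  fixes f g :: "'a::real_normed_vector \<Rightarrow> real"
  assumes "open S" "smooth_on S f" "smooth_on S g"
  shows "smooth_on S (\<lambda>x. (f x, g x))"
proof -
  have "smooth_on S (\<lambda>x. f x *\<^sub>R (1::real, 0::real) + g x *\<^sub>R (0, 1))"
    by (intro smooth_on_add smooth_on_scaleR smooth_on_const assms)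
  then show ?thesis by simp
qed

lemma smooth_on_fst: "smooth_on S fst" and smooth_on_snd: "smooth_on S snd"
  by (intro smooth_on_bounded_linear bounded_linear_fst bounded_linear_snd)+

lemmas smooth_intros = smooth_on_add smooth_on_diff smooth_on_uminus smooth_on_mult
  smooth_on_scaleR smooth_on_inner smooth_on_const smooth_on_Pair smooth_on_fst smooth_on_snd

section \<open>Symmetry of second derivatives\<close>

text \<open>The second difference on the left does not change when \<open>X\<close> and \<open>Y\<close> are exchanged, while the
  right-hand side does: this is what forces second derivatives to be symmetric. It comes from
  the mean value theorem, applied in the direction \<open>X\<close> and then in the direction \<open>Y\<close>.\<close>

lemma second_difference_mean_value:
  fixes f :: "'a::real_normed_vector \<Rightarrow> real"
  assumes "smooth_on S f" "0 < k"
    and S: "\<And>s t. 0 \<le> s \<Longrightarrow> s \<le> k \<Longrightarrow> 0 \<le> t \<Longrightarrow> t \<le> k \<Longrightarrow> x + s *\<^sub>R X + t *\<^sub>R Y \<in> S"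
  shows "\<exists>s\<in>{0..k}. \<exists>t\<in>{0..k}. f (x + k *\<^sub>R X + k *\<^sub>R Y) - f (x + k *\<^sub>R X) - f (x + k *\<^sub>R Y) + f x
    = k * k * frechet_derivative (\<lambda>q. frechet_derivative f (at q) X) (at (x + s *\<^sub>R X + t *\<^sub>R Y)) Y"
proof -
  let ?A = "\<lambda>q. frechet_derivative f (at q) X"
  have line: "((\<lambda>r. F (c + r *\<^sub>R Z)) has_real_derivative frechet_derivative F (at (c + r *\<^sub>R Z)) Z) (at r)"
    if "smooth_on S F" "c + r *\<^sub>R Z \<in> S" for F :: "'a \<Rightarrow> real" and c Z r
  proof -
    note F = has_derivative_frechet[OF that]
    have "((\<lambda>r. F (c + r *\<^sub>R Z)) has_derivative (\<lambda>d. frechet_derivative F (at (c + r *\<^sub>R Z)) (d *\<^sub>R Z))) (at r)"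
      by (rule has_derivative_compose[of "\<lambda>r. c + r *\<^sub>R Z" _ _ _ F])
        (auto intro!: derivative_eq_intros F)
    then show ?thesis
      using linear_scale[OF has_derivative_linear[OF F]]
      by (simp add: has_field_derivative_def mult.commute[of _ "frechet_derivative F _ _"])
  qed
  have "\<exists>s. 0 < s \<and> s < k \<and> (f (x + k *\<^sub>R Y + k *\<^sub>R X) - f (x + k *\<^sub>R X)) - (f (x + k *\<^sub>R Y + 0 *\<^sub>R X) - f (x + 0 *\<^sub>R X))
      = (k - 0) * (?A (x + k *\<^sub>R Y + s *\<^sub>R X) - ?A (x + s *\<^sub>R X))"
  proof (rule MVT2[OF \<open>0 < k\<close>])
    fix s assume "0 \<le> s" "s \<le> k"
    then show "((\<lambda>s. f (x + k *\<^sub>R Y + s *\<^sub>R X) - f (x + s *\<^sub>R X)) has_real_derivative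
        ?A (x + k *\<^sub>R Y + s *\<^sub>R X) - ?A (x + s *\<^sub>R X)) (at s)"
      using S[of s k] S[of s 0] assms(2)
      by (intro DERIV_diff line[OF assms(1)]) (auto simp: algebra_simps)
  qed
  then obtain s where s: "0 < s" "s < k"
    "(f (x + k *\<^sub>R Y + k *\<^sub>R X) - f (x + k *\<^sub>R X)) - (f (x + k *\<^sub>R Y) - f x)
      = k * (?A (x + k *\<^sub>R Y + s *\<^sub>R X) - ?A (x + s *\<^sub>R X))" by auto
  have "\<exists>t. 0 < t \<and> t < k \<and> ?A (x + s *\<^sub>R X + k *\<^sub>R Y) - ?A (x + s *\<^sub>R X + 0 *\<^sub>R Y)
      = (k - 0) * frechet_derivative ?A (at (x + s *\<^sub>R X + t *\<^sub>R Y)) Y"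
    using s S by (intro MVT2[OF \<open>0 < k\<close>] line smooth_on_frechet assms(1)) auto
  then obtain t where t: "0 < t" "t < k" "?A (x + s *\<^sub>R X + k *\<^sub>R Y) - ?A (x + s *\<^sub>R X)
      = k * frechet_derivative ?A (at (x + s *\<^sub>R X + t *\<^sub>R Y)) Y" by auto
  have "x + k *\<^sub>R Y + s *\<^sub>R X = x + s *\<^sub>R X + k *\<^sub>R Y" "x + k *\<^sub>R Y + k *\<^sub>R X = x + k *\<^sub>R X + k *\<^sub>R Y"
    by (simp_all add: algebra_simps)
  then show ?thesis using s t by (intro bexI[of _ s] bexI[of _ t]) (auto simp: algebra_simps)
qed

text \<open>Both mixed derivatives take a common value at points arbitrarily close to \<open>x\<close>, and they are
  continuous.\<close>

lemma symmetric_second_derivative_real: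
  fixes f :: "'a::real_normed_vector \<Rightarrow> real"
  assumes "open S" "smooth_on S f" "x \<in> S"
  shows "frechet_derivative (\<lambda>q. frechet_derivative f (at q) X) (at x) Y =
    frechet_derivative (\<lambda>q. frechet_derivative f (at q) Y) (at x) X"
proof -
  let ?A = "\<lambda>q. frechet_derivative (\<lambda>q. frechet_derivative f (at q) X) (at q) Y"
  let ?B = "\<lambda>q. frechet_derivative (\<lambda>q. frechet_derivative f (at q) Y) (at q) X"
  have "isCont ?A x" "isCont ?B x"
    using smooth_on_imp_continuous_on[OF smooth_on_frechet[OF smooth_on_frechet[OF assms(2)]]]
      assms by (auto simp: continuous_on_eq_continuous_at)
  have "dist (?A x) (?B x) \<le> e + e" if "e > 0" for e
  proof -
    obtain r1 where r1: "r1 > 0" "\<And>q. dist q x < r1 \<Longrightarrow> dist (?A q) (?A x) < e"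
      using \<open>isCont ?A x\<close> \<open>e > 0\<close> unfolding continuous_at_eps_delta by metis
    obtain r2 where r2: "r2 > 0" "\<And>q. dist q x < r2 \<Longrightarrow> dist (?B q) (?B x) < e"
      using \<open>isCont ?B x\<close> \<open>e > 0\<close> unfolding continuous_at_eps_delta by metis
    obtain r3 where r3: "r3 > 0" "ball x r3 \<subseteq> S" using assms(1,3) openE by blast
    define r where "r = min r1 (min r2 r3)"
    \<comment> \<open>This size keeps the parallelogram spanned by \<open>k X\<close> and \<open>k Y\<close> inside the ball of radius \<open>r\<close>.\<close>
    define k where "k = r / (norm X + norm Y + 1)"
    have "r > 0" using r1 r2 r3 by (simp add: r_def)
    then have "k > 0" by (simp add: k_def add_nonneg_pos)
    have near: "dist (x + s *\<^sub>R X + t *\<^sub>R Y) x < r" if "0 \<le> s" "s \<le> k" "0 \<le> t" "t \<le> k" for s t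
    proof -
      have "dist (x + s *\<^sub>R X + t *\<^sub>R Y) x = norm (s *\<^sub>R X + t *\<^sub>R Y)" by (simp add: dist_norm)
      also have "\<dots> \<le> norm (s *\<^sub>R X) + norm (t *\<^sub>R Y)" by (rule norm_triangle_ineq)
      also have "\<dots> \<le> k * norm X + k * norm Y" using that by (auto intro!: add_mono mult_right_mono)
      also have "\<dots> < k * (norm X + norm Y + 1)" using \<open>k > 0\<close> by (simp add: algebra_simps)
      also have "\<dots> = r"
        using add_nonneg_pos[of "norm X + norm Y" 1] by (simp add: k_def)
      finally show ?thesis .
    qed
    have inS: "x + s *\<^sub>R X + t *\<^sub>R Y \<in> S" if "0 \<le> s" "s \<le> k" "0 \<le> t" "t \<le> k" for s t
      using near[OF that] r3(2) by (auto simp: r_def dist_commute)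
    obtain s t where st: "s \<in> {0..k}" "t \<in> {0..k}"
      "f (x + k *\<^sub>R X + k *\<^sub>R Y) - f (x + k *\<^sub>R X) - f (x + k *\<^sub>R Y) + f x = k * k * ?A (x + s *\<^sub>R X + t *\<^sub>R Y)"
      using second_difference_mean_value[OF assms(2) \<open>k > 0\<close> inS] by blast
    have "\<exists>s\<in>{0..k}. \<exists>t\<in>{0..k}. f (x + k *\<^sub>R Y + k *\<^sub>R X) - f (x + k *\<^sub>R Y) - f (x + k *\<^sub>R X) + f x
        = k * k * ?B (x + s *\<^sub>R Y + t *\<^sub>R X)"
    proof (rule second_difference_mean_value[OF assms(2) \<open>k > 0\<close>])
      fix s t :: real assume "0 \<le> s" "s \<le> k" "0 \<le> t" "t \<le> k"
      then have "x + t *\<^sub>R X + s *\<^sub>R Y \<in> S" using inS by blast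
      moreover have "x + t *\<^sub>R X + s *\<^sub>R Y = x + s *\<^sub>R Y + t *\<^sub>R X" by simp
      ultimately show "x + s *\<^sub>R Y + t *\<^sub>R X \<in> S" by simp
    qed
    then obtain s' t' where st': "s' \<in> {0..k}" "t' \<in> {0..k}"
      "f (x + k *\<^sub>R Y + k *\<^sub>R X) - f (x + k *\<^sub>R Y) - f (x + k *\<^sub>R X) + f x = k * k * ?B (x + s' *\<^sub>R Y + t' *\<^sub>R X)"
      by blast
    have "x + k *\<^sub>R Y + k *\<^sub>R X = x + k *\<^sub>R X + k *\<^sub>R Y" by (simp add: algebra_simps)
    then have eq: "?A (x + s *\<^sub>R X + t *\<^sub>R Y) = ?B (x + s' *\<^sub>R Y + t' *\<^sub>R X)"
      using st(3) st'(3) \<open>k > 0\<close> by (smt (verit) mult_pos_pos mult_left_cancel)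
    have swap: "x + s' *\<^sub>R Y + t' *\<^sub>R X = x + t' *\<^sub>R X + s' *\<^sub>R Y" by simp
    have "dist (x + s' *\<^sub>R Y + t' *\<^sub>R X) x < r"
      unfolding swap using near[of t' s'] st'(1,2) by simp
    then have "dist (?A (x + s *\<^sub>R X + t *\<^sub>R Y)) (?A x) < e"
      "dist (?B (x + s' *\<^sub>R Y + t' *\<^sub>R X)) (?B x) < e"
      using near[of s t] st r1(2) r2(2) by (simp_all add: r_def)
    then show ?thesis unfolding eq by (smt (verit) dist_triangle dist_commute)
  qed
  then have "dist (?A x) (?B x) \<le> 0 + e" if "e > 0" for e
    by (metis add_0 field_sum_of_halves half_gt_zero that)
  then have "dist (?A x) (?B x) \<le> 0" by (rule field_le_epsilon)
  then show ?thesis by simp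
qed

lemma symmetric_second_derivative:
  fixes f :: "'a::real_normed_vector \<Rightarrow> 'b::real_inner"
  assumes "open S" "smooth_on S f" "x \<in> S"
  shows "frechet_derivative (\<lambda>q. frechet_derivative f (at q) X) (at x) Y =
    frechet_derivative (\<lambda>q. frechet_derivative f (at q) Y) (at x) X" (is "?l = ?r")
proof -
  have d: "frechet_derivative (\<lambda>q. F q \<bullet> e) (at q) Z = frechet_derivative F (at q) Z \<bullet> e"
    if "smooth_on S F" "q \<in> S" for F :: "'a \<Rightarrow> 'b" and e q Z
    using frechet_derivative_at[OF has_derivative_inner_left[OF has_derivative_frechet[OF that]], of e]
    by metis
  have dd: "frechet_derivative (\<lambda>q. frechet_derivative (\<lambda>q. f q \<bullet> e) (at q) Z) (at x) Z' =
      frechet_derivative (\<lambda>q. frechet_derivative f (at q) Z) (at x) Z' \<bullet> e" for Z Z' e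
  proof -
    have "((\<lambda>q. frechet_derivative (\<lambda>q. f q \<bullet> e) (at q) Z) has_derivative
       (\<lambda>Z'. frechet_derivative (\<lambda>q. frechet_derivative f (at q) Z) (at x) Z' \<bullet> e)) (at x)"
      by (rule has_derivative_transform_within_open[OF has_derivative_inner_left[OF
            has_derivative_frechet[OF smooth_on_frechet[OF assms(2)] assms(3)]] assms(1,3)])
        (simp add: d[OF assms(2)])
    then show ?thesis by (metis frechet_derivative_at)
  qed
  have "?l \<bullet> e = ?r \<bullet> e" for e
    using symmetric_second_derivative_real[of S "\<lambda>q. f q \<bullet> e" x X Y] assms
      smooth_on_inner[OF assms(1,2) smooth_on_const] unfolding dd by blast
  then show ?thesis using vector_eq_rdot by blast
qed

section \<open>Directional derivatives in the plane\<close>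

lemma pd_conv_frechet: "dirder (\<lambda>_. e) F = (\<lambda>q. frechet_derivative F (at q) e)"
  by (rule ext) (simp add: dirder_def)

lemma frechet_derivative_plane:
  fixes F :: "plane \<Rightarrow> 'b::real_normed_vector"
  assumes "F differentiable (at w)"
  shows "frechet_derivative F (at w) X = fst X *\<^sub>R pd_u F w + snd X *\<^sub>R pd_v F w"
proof -
  have lin: "linear (frechet_derivative F (at w))"
    using assms by (simp add: linear_frechet_derivative)
  have "X = fst X *\<^sub>R (1, 0) + snd X *\<^sub>R (0, 1)" by (simp add: prod_eq_iff)
  then show ?thesis
    by (metis (no_types, lifting) dirder_def linear_add[OF lin] linear_scale[OF lin])
qed

lemma dirder_plane:
  assumes "F differentiable (at w)"
  shows "dirder X F w = fst (X w) *\<^sub>R pd_u F w + snd (X w) *\<^sub>R pd_v F w"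
  unfolding dirder_def[of X] using frechet_derivative_plane[OF assms] by simp

lemma smooth_on_pd: "smooth_on S F \<Longrightarrow> smooth_on S (dirder (\<lambda>_. e) F)"
  unfolding pd_conv_frechet by (rule smooth_on_frechet)

lemma smooth_on_dirder:
  assumes "open S" "smooth_on S F" "smooth_on S X"
  shows "smooth_on S (dirder X F)"
proof (rule smooth_on_cong[OF assms(1)])
  show "smooth_on S (\<lambda>w. (X w \<bullet> (1, 0)) *\<^sub>R pd_u F w + (X w \<bullet> (0, 1)) *\<^sub>R pd_v F w)"
    by (intro smooth_intros smooth_on_pd assms)
  show "(X w \<bullet> (1, 0)) *\<^sub>R pd_u F w + (X w \<bullet> (0, 1)) *\<^sub>R pd_v F w = dirder X F w" if "w \<in> S" for w
    using dirder_plane[OF smooth_on_imp_differentiable[OF assms(2) that], of X]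
    by (simp add: inner_prod_def)
qed

lemma dirder_cong:
  assumes "open S" "w \<in> S" "F differentiable (at w)" "\<And>q. q \<in> S \<Longrightarrow> F q = G q"
  shows "dirder X F w = dirder X G w"
  unfolding dirder_def using frechet_derivative_transform_within_open[OF assms(3,1,2,4)] by simp

lemma (in bounded_bilinear) dirder_bilinear:
  assumes "f differentiable (at w)" "g differentiable (at w)"
  shows "dirder X (\<lambda>q. prod (f q) (g q)) w = prod (f w) (dirder X g w) + prod (dirder X f w) (g w)"
proof -
  have "((\<lambda>q. prod (f q) (g q)) has_derivative (\<lambda>h. prod (f w) (frechet_derivative g (at w) h) +
      prod (frechet_derivative f (at w) h) (g w))) (at w)"
    by (intro FDERIV) (use assms frechet_derivative_works in auto)
  from frechet_derivative_at[OF this, symmetric] show ?thesis by (simp add: dirder_def)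
qed

lemmas dirder_scaleR = bounded_bilinear.dirder_bilinear[OF bounded_bilinear_scaleR]
lemmas dirder_inner = bounded_bilinear.dirder_bilinear[OF bounded_bilinear_inner]

lemma dirder_add:
  assumes "f differentiable (at w)" "g differentiable (at w)"
  shows "dirder X (\<lambda>q. f q + g q) w = dirder X f w + dirder X g w"
proof -
  have "((\<lambda>q. f q + g q) has_derivative (\<lambda>h. frechet_derivative f (at w) h +
      frechet_derivative g (at w) h)) (at w)"
    by (intro has_derivative_add) (use assms frechet_derivative_works in auto)
  from frechet_derivative_at[OF this, symmetric] show ?thesis by (simp add: dirder_def)
qed

lemma dirder_snd: "dirder X snd w = snd (X w)"
  using frechet_derivative_at[OF has_derivative_snd[OF has_derivative_ident], of w]
  by (simp add: dirder_def)

lemma dirder_const: "dirder X (\<lambda>q. c) w = 0"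
  by (simp add: dirder_def)

lemma mixed_partials:
  fixes F :: "plane \<Rightarrow> 'b::real_inner"
  assumes "open S" "smooth_on S F" "w \<in> S"
  shows "pd_v (pd_u F) w = pd_u (pd_v F) w"
  using symmetric_second_derivative[OF assms] by (simp add: pd_conv_frechet)

text \<open>Many identities hold on the singular curve only. They may still be differentiated along it.\<close>

lemma pd_u_axis_cong:
  fixes F G :: "plane \<Rightarrow> 'b::real_normed_vector"
  assumes "open S" "w \<in> S" "snd w = 0" "F differentiable (at w)" "G differentiable (at w)"
    and "\<And>q. q \<in> S \<Longrightarrow> snd q = 0 \<Longrightarrow> F q = G q"
  shows "pd_u F w = pd_u G w"
proof -
  let ?l = "\<lambda>r::real. w + r *\<^sub>R (1, 0)"
  have line: "((\<lambda>r. H (?l r)) has_vector_derivative pd_u H w) (at 0)"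
    if "H differentiable (at w)" for H :: "plane \<Rightarrow> 'b"
  proof -
    have H: "(H has_derivative frechet_derivative H (at w)) (at (?l 0))"
      using that frechet_derivative_works[of H "at w"] by (simp only: scaleR_zero_left add_0_right)
    have "((\<lambda>r. H (?l r)) has_derivative (\<lambda>r. frechet_derivative H (at w) (r *\<^sub>R (1, 0)))) (at 0)"
    proof (rule has_derivative_compose[of ?l _ _ _ H, OF _ H])
      show "(?l has_derivative (\<lambda>r. r *\<^sub>R (1, 0))) (at 0)"
        by (auto intro!: derivative_eq_intros)
    qed
    then show ?thesis
      using linear_scale[OF has_derivative_linear[OF H]]
      by (simp add: has_vector_derivative_def dirder_def del: scaleR_Pair)
  qed
  have "open (?l -` S)"
    by (intro open_vimage assms(1) continuous_intros)
  moreover have "F (?l r) = G (?l r)" if "r \<in> ?l -` S" for r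
    using assms(3,6) that by simp
  ultimately have "((\<lambda>r. G (?l r)) has_vector_derivative pd_u F w) (at 0)"
    using has_vector_derivative_transform_within_open[OF line[OF assms(4)]] assms(2)
    by (metis (no_types, lifting) add.right_neutral scaleR_zero_left vimageI)
  then show ?thesis using line[OF assms(5)] vector_derivative_unique_at by blast
qed

lemma dirder_compose:
  assumes "F differentiable (at (\<phi> w))" "\<phi> differentiable (at w)"
    and "frechet_derivative \<phi> (at w) (X' w) = X (\<phi> w)"
  shows "dirder X F (\<phi> w) = dirder X' (F \<circ> \<phi>) w"
  using frechet_derivative_compose[OF assms(2,1)] assms(3) by (simp add: dirder_def)


section \<open>Division by a coordinate\<close>

text \<open>The value on the axis is the limit of the quotient when \<open>F\<close> vanishes there.\<close>

definition axis_quotient :: "(plane \<Rightarrow> real) \<Rightarrow> plane \<Rightarrow> real" where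
  "axis_quotient F w = (if snd w = 0 then pd_v F w else F w / snd w)"

lemma axis_quotient: "(snd w = 0 \<Longrightarrow> F w = 0) \<Longrightarrow> F w = snd w * axis_quotient F w"
  by (simp add: axis_quotient_def)

text \<open>For \<open>F = 0\<close> on the axis, \<open>F(u,v) = \<integral> d/dt F(u,tv) dt = v \<integral> F\<^sub>v(u,tv) dt\<close> over
  \<open>0 \<le> t \<le> 1\<close>, so the quotient by \<open>v\<close> is an integral depending on the parameters \<open>u, v\<close>. The
  weights \<open>t ^ j\<close> make the family of such integrals closed under partial differentiation, which
  gives smoothness by induction.\<close>

definition shrink_integral :: "nat \<Rightarrow> (plane \<Rightarrow> real) \<Rightarrow> plane \<Rightarrow> real" where
  "shrink_integral j G w = integral {0..1} (\<lambda>t. t ^ j * G (fst w, t * snd w))"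

context
  fixes I :: "real set" and r :: real and S :: "plane set"
  assumes I: "open I" "convex I" and S: "S = I \<times> {-r<..<r}"
begin

lemma strip: "open S" "convex S" and shrink_in_strip: "w \<in> S \<Longrightarrow> 0 \<le> t \<Longrightarrow> t \<le> 1 \<Longrightarrow> (fst w, t * snd w) \<in> S"
proof -
  show "open S" "convex S" unfolding S by (auto intro: open_Times convex_Times I)
  assume w: "w \<in> S" "0 \<le> t" "t \<le> 1"
  then have "\<bar>t * snd w\<bar> \<le> 1 * \<bar>snd w\<bar>" unfolding abs_mult by (intro mult_right_mono) auto
  then show "(fst w, t * snd w) \<in> S" using w by (auto simp: S)
qed

lemma shrink_integrand_continuous:
  assumes "smooth_on S G"
  shows "continuous_on (S \<times> {0..1}) (\<lambda>(w, t). t ^ j * G (fst w, t * snd w))"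
proof -
  have "continuous_on (S \<times> {0..1}) (\<lambda>x. G (fst (fst x), snd x * snd (fst x)))"
    by (rule continuous_on_compose2[OF smooth_on_imp_continuous_on[OF assms]])
      (auto intro!: continuous_intros shrink_in_strip)
  then show ?thesis by (auto simp: split_beta intro!: continuous_intros)
qed

lemma shrink_integrable:
  assumes "smooth_on S G" "w \<in> S"
  shows "(\<lambda>t. t ^ j * G (fst w, t * snd w)) integrable_on {0..1}"
proof (rule integrable_continuous_real)
  have "continuous_on {0..1} (\<lambda>t. (\<lambda>(w, t). t ^ j * G (fst w, t * snd w)) (w, t))"
    by (rule continuous_on_compose2[OF shrink_integrand_continuous[OF assms(1)]])
      (use assms(2) in \<open>auto intro!: continuous_intros\<close>)
  then show "continuous_on {0..1} (\<lambda>t. t ^ j * G (fst w, t * snd w))" by simp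
qed

lemma shrink_integral_has_derivative:
  assumes "smooth_on S G" "w \<in> S"
  shows "(shrink_integral j G has_derivative (\<lambda>X. fst X * shrink_integral j (pd_u G) w
    + snd X * shrink_integral (Suc j) (pd_v G) w)) (at w)"
proof -
  let ?A = "\<lambda>w t. t ^ j * pd_u G (fst w, t * snd w)"
  let ?B = "\<lambda>w t. t ^ Suc j * pd_v G (fst w, t * snd w)"
  let ?D = "\<lambda>w t. ?A w t *\<^sub>R (fst_blinfun :: plane \<Rightarrow>\<^sub>L real) + ?B w t *\<^sub>R snd_blinfun"
  note GuGv = smooth_on_pd[OF assms(1)]
  have cont: "continuous_on (S \<times> {0..1}) (\<lambda>(w, t). ?D w t)"
    unfolding split_beta
    by (intro continuous_on_add continuous_on_scaleR continuous_on_const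
        shrink_integrand_continuous[OF GuGv, unfolded split_beta])
  have "((\<lambda>w. integral (cbox 0 1) (\<lambda>t. t ^ j * G (fst w, t * snd w))) has_derivative
      integral (cbox 0 1) (?D w)) (at w within S)"
  proof (rule leibniz_rule)
    fix x t assume x: "x \<in> S" and t: "t \<in> cbox 0 (1::real)"
    let ?m = "\<lambda>w::plane. (fst w, t * snd w)"
    have m: "?m x \<in> S" using x t shrink_in_strip by auto
    note G = has_derivative_frechet[OF assms(1) m]
    have "((\<lambda>w. G (?m w)) has_derivative (\<lambda>X. frechet_derivative G (at (?m x)) (?m X))) (at x)"
      by (rule has_derivative_compose[of ?m _ _ _ G]) (auto intro!: derivative_eq_intros G)
    then have "((\<lambda>w. t ^ j * G (?m w)) has_derivative
        (\<lambda>X. t ^ j * frechet_derivative G (at (?m x)) (?m X))) (at x)"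
      by (rule has_derivative_mult_right)
    moreover have "(\<lambda>X. t ^ j * frechet_derivative G (at (?m x)) (?m X)) = blinfun_apply (?D x t)"
      by (rule ext) (simp add: frechet_derivative_plane[OF smooth_on_imp_differentiable[OF assms(1) m]]
          blinfun.bilinear_simps algebra_simps)
    ultimately show "((\<lambda>w. t ^ j * G (?m w)) has_derivative blinfun_apply (?D x t)) (at x within S)"
      by (simp add: has_derivative_at_withinI)
  next
    show "continuous_on (S \<times> cbox 0 1) (\<lambda>(w, t). ?D w t)" using cont by simp
  qed (use shrink_integrable assms strip in auto)
  moreover have "blinfun_apply (integral (cbox 0 1) (?D w)) X
      = fst X * shrink_integral j (pd_u G) w + snd X * shrink_integral (Suc j) (pd_v G) w" for X
  proof -
    have "continuous_on {0..1} (\<lambda>t. (\<lambda>(w, t). ?D w t) (w, t))"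
      by (rule continuous_on_compose2[OF cont])
        (use assms(2) in \<open>auto intro!: continuous_intros\<close>)
    then have "continuous_on (cbox 0 1) (?D w)" by (simp only: prod.case box_real)
    then have "?D w integrable_on cbox 0 1" by (rule integrable_continuous)
    then have "blinfun_apply (integral (cbox 0 1) (?D w)) X
        = integral {0..1} (\<lambda>t. fst X * ?A w t + snd X * ?B w t)"
      by (simp add: blinfun_apply_integral blinfun.bilinear_simps algebra_simps)
    also have "\<dots> = fst X * shrink_integral j (pd_u G) w + snd X * shrink_integral (Suc j) (pd_v G) w"
      unfolding shrink_integral_def using shrink_integrable[OF GuGv assms(2)]
      by (subst integral_add) (auto simp del: power_Suc intro: integrable_on_mult_right)
    finally show ?thesis .
  qed
  ultimately have "((\<lambda>w. integral (cbox 0 1) (\<lambda>t. t ^ j * G (fst w, t * snd w))) has_derivative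
      (\<lambda>X. fst X * shrink_integral j (pd_u G) w + snd X * shrink_integral (Suc j) (pd_v G) w))
      (at w within S)"
    by (blast intro: has_derivative_eq_rhs)
  then show ?thesis
    using at_within_open[OF assms(2) strip(1)] by (simp add: shrink_integral_def[abs_def])
qed

lemma smooth_on_shrink_integral:
  assumes "smooth_on S G"
  shows "smooth_on S (shrink_integral j G)"
proof -
  have "Ck_on k (shrink_integral j G) S" for k
    using assms
  proof (induction k arbitrary: j G)
    case 0
    have "shrink_integral j G differentiable_on S"
      using shrink_integral_has_derivative[OF 0] unfolding differentiable_on_def
      by (meson differentiableI differentiable_at_withinI)
    then show ?case by (simp add: differentiable_imp_continuous_on)
  next
    case (Suc k)
    note d = shrink_integral_has_derivative[OF Suc.prems]
    show ?case unfolding Ck_on.simps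
    proof (intro conjI ballI allI)
      fix w assume "w \<in> S" then show "shrink_integral j G differentiable at w"
        using d differentiable_def by blast
    next
      fix X :: plane
      have "Ck_on k (\<lambda>w. fst X * shrink_integral j (pd_u G) w
          + snd X * shrink_integral (Suc j) (pd_v G) w) S"
        by (intro Ck_on_add bounded_bilinear.Ck_on_bilinear[OF bounded_bilinear_mult] Ck_on_const
            strip Suc.IH smooth_on_pd Suc.prems)
      then show "Ck_on k (\<lambda>w. frechet_derivative (shrink_integral j G) (at w) X) S"
        by (rule Ck_on_cong[OF strip(1), rotated])
          (simp add: frechet_derivative_at[OF d, symmetric])
    qed
  qed
  then show ?thesis unfolding smooth_on_def by blast
qed

lemma axis_quotient_eq_shrink_integral:
  assumes "smooth_on S F" "\<And>w. w \<in> S \<Longrightarrow> snd w = 0 \<Longrightarrow> F w = 0" "w \<in> S"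
  shows "axis_quotient F w = shrink_integral 0 (pd_v F) w"
proof (cases "snd w = 0")
  case True
  then show ?thesis
    by (simp add: axis_quotient_def shrink_integral_def) (metis prod.collapse)
next
  case False
  let ?m = "\<lambda>t. (fst w, t * snd w)"
  have "((\<lambda>t. F (?m t)) has_vector_derivative snd w * pd_v F (?m t)) (at t within {0..1})"
    if "t \<in> {0..1}" for t
  proof -
    have m: "?m t \<in> S" using shrink_in_strip assms(3) that by auto
    note F = has_derivative_frechet[OF assms(1) m]
    have "((\<lambda>t. F (?m t)) has_derivative (\<lambda>d. frechet_derivative F (at (?m t)) (0, d * snd w))) (at t)"
      by (rule has_derivative_compose[of ?m _ _ _ F]) (auto intro!: derivative_eq_intros F)
    then show ?thesis
      by (simp add: frechet_derivative_plane[OF smooth_on_imp_differentiable[OF assms(1) m]]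
          has_vector_derivative_def has_derivative_at_withinI mult.assoc)
  qed
  then have "((\<lambda>t. snd w * pd_v F (?m t)) has_integral F (?m 1) - F (?m 0)) {0..1}"
    by (intro fundamental_theorem_of_calculus) auto
  moreover have "F (?m 0) = 0" using assms(2) shrink_in_strip[OF assms(3), of 0] by simp
  moreover have "F (?m 1) = F w" by simp
  ultimately have "((\<lambda>t. snd w * pd_v F (?m t)) has_integral F w) {0..1}" by simp
  then have "integral {0..1} (\<lambda>t. snd w * pd_v F (?m t)) = F w" by (rule integral_unique)
  then show ?thesis using False
    by (simp add: axis_quotient_def shrink_integral_def field_simps)
qed

end

text \<open>Near the axis the integral formula applies on a rectangle; elsewhere the quotient is an ordinary
  quotient of smooth functions.\<close>

lemma smooth_on_axis_quotient:
  assumes "open W" "smooth_on W F" "\<And>w. w \<in> W \<Longrightarrow> snd w = 0 \<Longrightarrow> F w = 0"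
  shows "smooth_on W (axis_quotient F)"
proof (rule smooth_on_local)
  fix w assume w: "w \<in> W"
  show "\<exists>T. open T \<and> w \<in> T \<and> smooth_on T (axis_quotient F)"
  proof (cases "snd w = 0")
    case True
    obtain A B where AB: "open A" "open B" "w \<in> A \<times> B" "A \<times> B \<subseteq> W"
      using open_prod_elim[OF assms(1) w] by blast
    obtain r where r: "r > 0" "ball (fst w) r \<subseteq> A" using AB openE by (metis mem_Sigma_iff prod.collapse)
    obtain s where s: "s > 0" "ball (snd w) s \<subseteq> B" using AB openE by (metis mem_Sigma_iff prod.collapse)
    have B: "ball (snd w) s = {-s<..<s}" using True by (simp add: ball_eq_greaterThanLessThan)
    define T where "T = ball (fst w) r \<times> {-s<..<s}"
    have T: "open T" "w \<in> T" "T \<subseteq> W"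
      using AB r s True unfolding T_def B by (auto intro!: open_Times simp: mem_Times_iff)
    note F = smooth_on_subset[OF assms(2) T(3)]
    have "smooth_on T (axis_quotient F)"
    proof (rule smooth_on_cong[OF T(1) smooth_on_shrink_integral[OF _ _ T_def smooth_on_pd[OF F]]])
      show "shrink_integral 0 (pd_v F) q = axis_quotient F q" if "q \<in> T" for q
        using axis_quotient_eq_shrink_integral[OF open_ball convex_ball T_def F _ that]
          assms(3) T(3) by (metis subsetD)
    qed auto
    then show ?thesis using T by blast
  next
    case False
    define T where "T = W \<inter> snd -` (- {0})"
    have T: "open T" "w \<in> T" "T \<subseteq> W"
      using assms(1) w False unfolding T_def by (auto intro!: open_Int open_vimage_snd)
    have "smooth_on T (\<lambda>w. F w / snd w)"
      by (intro smooth_on_divide T smooth_on_snd smooth_on_subset[OF assms(2) T(3)]) (simp add: T_def)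
    then have "smooth_on T (axis_quotient F)"
      by (rule smooth_on_cong[OF T(1)]) (simp add: T_def axis_quotient_def)
    then show ?thesis using T by blast
  qed
qed

section \<open>Determinants and parallel vectors\<close>

lemma det3_triple: "det3 a b c = cross3 a b \<bullet> c"
  unfolding det3_def dot_cross_det[symmetric] using cross_triple[of b c a] by (metis inner_commute cross_triple)

text \<open>Determinants are evaluated below from inner products alone, by pairing the unknown determinant
  with that of a known frame. The matrix of inner products on the right is \<open>A B\<^sup>T\<close>, where the rows
  of \<open>A\<close> and \<open>B\<close> are the two triples.\<close>

lemma det3_gram:
  "det3 a b c * det3 x y z =
    (a \<bullet> x) * (b \<bullet> y) * (c \<bullet> z) + (a \<bullet> y) * (b \<bullet> z) * (c \<bullet> x) + (a \<bullet> z) * (b \<bullet> x) * (c \<bullet> y)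
    - (a \<bullet> x) * (b \<bullet> z) * (c \<bullet> y) - (a \<bullet> y) * (b \<bullet> x) * (c \<bullet> z) - (a \<bullet> z) * (b \<bullet> y) * (c \<bullet> x)"
proof -
  have "det3 a b c * det3 x y z
      = det ((vector [a, b, c] :: real^3^3) ** transpose (vector [x, y, z] :: real^3^3))"
    by (simp add: det3_def det_mul det_transpose)
  then show ?thesis
    by (simp add: det_3 matrix_matrix_mult_def transpose_def vector_3 inner_vec_def)
qed

lemma parallel_iff: "parallel X Y \<longleftrightarrow> det2 X Y = 0"
proof
  assume "parallel X Y"
  then obtain a b where ab: "a \<noteq> 0 \<or> b \<noteq> 0" "a * fst X + b * fst Y = 0" "a * snd X + b * snd Y = 0"
    by (auto simp: parallel_def prod_eq_iff)
  then have "a * det2 X Y = 0" "b * det2 X Y = 0" unfolding det2_def by algebra+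
  then show "det2 X Y = 0" using ab(1) by auto
next
  assume d: "det2 X Y = 0"
  show "parallel X Y"
  proof (cases "X = 0")
    case True then show ?thesis unfolding parallel_def by (intro exI[of _ 1] exI[of _ 0]) auto
  next
    case False
    then consider "fst X \<noteq> 0" | "snd X \<noteq> 0" by (auto simp: prod_eq_iff)
    then show ?thesis
    proof cases
      case 1 then show ?thesis unfolding parallel_def
        by (intro exI[of _ "fst Y"] exI[of _ "- fst X"]) (use d in \<open>auto simp: det2_def prod_eq_iff\<close>)
    next
      case 2 then show ?thesis unfolding parallel_def
        by (intro exI[of _ "snd Y"] exI[of _ "- snd X"])
          (use d in \<open>auto simp: det2_def prod_eq_iff mult.commute\<close>)
    qed
  qed
qed

section \<open>Pure frontals in adapted coordinates\<close>

text \<open>For a general adapted pair the cuspidal torsion is a quotient in which almost everything cancels.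
  Here \<open>e\<close> and \<open>k\<close> stand for \<open>g\<^sub>u\<close> and \<open>g\<^sub>v\<^sub>v\<close>, \<open>x\<close> and \<open>y\<close> for their derivatives along the
  curve: the second summand of the torsion removes exactly the contribution of \<open>x\<close>, which is
  caused by the component \<open>\<alpha>\<close> of \<open>\<eta>\<eta>f\<close> along the curve.\<close>

lemma torsion_quotient:
  fixes e k x y :: "real^3"
  assumes "e \<bullet> e = 1" "k \<bullet> k = 1" "e \<bullet> k = 0" "a \<noteq> 0" "\<beta> \<noteq> 0"
    and "p = a *\<^sub>R e" "q = \<alpha> *\<^sub>R e + \<beta> *\<^sub>R k"
    and "r = a *\<^sub>R (\<alpha> *\<^sub>R x + \<alpha>' *\<^sub>R e + \<beta> *\<^sub>R y + \<beta>' *\<^sub>R k)" "s = a *\<^sub>R (a *\<^sub>R x + a' *\<^sub>R e)"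
  shows "det3 p q r / (norm (cross3 p q))\<^sup>2
      - det3 p q s * (p \<bullet> q) / ((norm p)\<^sup>2 * (norm (cross3 p q))\<^sup>2) = det3 e k y"
proof -
  have pq: "cross3 p q = (a * \<beta>) *\<^sub>R cross3 e k"
    using assms(6,7) by (simp add: cross_add_right cross_mult_left cross_mult_right)
  have "(norm (cross3 e k))\<^sup>2 = 1"
    using assms(1-3) by (simp add: dot_cross power2_norm_eq_inner inner_commute[of k e])
  then have n: "(norm (cross3 p q))\<^sup>2 = (a * \<beta>)\<^sup>2" by (simp add: pq power_mult_distrib)
  have e: "cross3 e k \<bullet> e = 0" "cross3 e k \<bullet> k = 0"
    by (metis dot_cross_self(1) inner_commute, metis dot_cross_self(2) inner_commute)
  have r: "det3 p q r = a * \<beta> * a * (\<alpha> * (cross3 e k \<bullet> x) + \<beta> * (cross3 e k \<bullet> y))"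
    by (simp add: det3_triple pq assms(8) inner_add_right e algebra_simps)
  have s: "det3 p q s = a * \<beta> * a * a * (cross3 e k \<bullet> x)"
    by (simp add: det3_triple pq assms(9) inner_add_right e)
  have "p \<bullet> q = a * \<alpha>" "(norm p)\<^sup>2 = a\<^sup>2"
    using assms(1,3,6,7) unfolding power2_norm_eq_inner
    by (simp_all add: inner_add_right power2_eq_square)
  then show ?thesis unfolding r s n
    using assms(4,5) by (simp add: det3_triple field_simps power2_eq_square)
qed

lemma pd_v_pd_v_axis:
  fixes g h :: "plane \<Rightarrow> 'a::real_normed_vector"
  assumes "open W" "smooth_on W g" "smooth_on W h" "\<And>q. q \<in> W \<Longrightarrow> pd_v g q = snd q *\<^sub>R h q"
    and w: "w \<in> W" "snd w = 0"
  shows "pd_v (pd_v g) w = h w"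
proof -
  note diff = smooth_on_imp_differentiable[OF _ w(1)]
  have "pd_v (pd_v g) w = pd_v (\<lambda>q. snd q *\<^sub>R h q) w"
    using assms by (intro dirder_cong[OF assms(1)] diff smooth_on_pd) auto
  also have "\<dots> = h w"
    using w dirder_scaleR[OF diff[OF smooth_on_snd] diff[OF assms(3)]]
    by (simp add: dirder_snd)
  finally show ?thesis .
qed

text \<open>A pure frontal \<open>g\<close> with unit normal \<open>n\<close>, seen in orthogonal adapted coordinates: the axis
  \<open>v = 0\<close> is the singular curve, and on it \<open>h\<close> is \<open>g\<^sub>v\<^sub>v\<close>. The assumption \<open>regular\<close> says
  that \<open>g\<close> is an immersion off the axis, and \<open>pure\<close> is the condition \<open>\<psi> = 0\<close>.\<close>

locale pure_frontal_chart =
  fixes W :: "plane set" and g n h :: "plane \<Rightarrow> real^3"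
  assumes open_W: "open W"
    and smooth_g: "smooth_on W g" and smooth_n: "smooth_on W n" and smooth_h: "smooth_on W h"
    and g_v: "w \<in> W \<Longrightarrow> pd_v g w = snd w *\<^sub>R h w"
    and n_unit: "w \<in> W \<Longrightarrow> n w \<bullet> n w = 1"
    and gu_n: "w \<in> W \<Longrightarrow> pd_u g w \<bullet> n w = 0"
    and gv_n: "w \<in> W \<Longrightarrow> pd_v g w \<bullet> n w = 0"
    and gu_unit: "w \<in> W \<Longrightarrow> snd w = 0 \<Longrightarrow> pd_u g w \<bullet> pd_u g w = 1"
    and h_unit: "w \<in> W \<Longrightarrow> snd w = 0 \<Longrightarrow> h w \<bullet> h w = 1"
    and gu_h: "w \<in> W \<Longrightarrow> snd w = 0 \<Longrightarrow> pd_u g w \<bullet> h w = 0"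
    and positive: "w \<in> W \<Longrightarrow> snd w = 0 \<Longrightarrow> det3 (pd_u g w) (h w) (n w) > 0"
    and regular: "w \<in> W \<Longrightarrow> snd w \<noteq> 0 \<Longrightarrow> form_E g w * form_G g w - (form_F g w)\<^sup>2 \<noteq> 0"
    and pure: "w \<in> W \<Longrightarrow> snd w = 0 \<Longrightarrow> det3 (pd_u g w) (n w) (pd_v n w) = 0"
begin

lemmas smooth_gu = smooth_on_pd[OF smooth_g, of "(1, 0)"]
lemmas smooth_gv = smooth_on_pd[OF smooth_g, of "(0, 1)"]
lemmas smooth_nu = smooth_on_pd[OF smooth_n, of "(1, 0)"]
lemmas smooth_nv = smooth_on_pd[OF smooth_n, of "(0, 1)"]
lemmas diff = smooth_on_imp_differentiable

lemma inner_derivative_zero: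
  fixes a b :: "plane \<Rightarrow> real^3"
  assumes "smooth_on W a" "smooth_on W b" "w \<in> W" "\<And>q. q \<in> W \<Longrightarrow> a q \<bullet> b q = c"
  shows "a w \<bullet> dirder X b w + dirder X a w \<bullet> b w = 0"
proof -
  have "dirder X (\<lambda>q. a q \<bullet> b q) w = dirder X (\<lambda>q. c) w"
    using assms by (intro dirder_cong[OF open_W] diff[OF smooth_on_inner[OF open_W]]) auto
  then show ?thesis using dirder_inner[OF diff[OF assms(1,3)] diff[OF assms(2,3)], of X]
    by (simp add: dirder_const)
qed

text \<open>Off the axis one can divide \<open>g\<^sub>v \<bullet> n = 0\<close> by \<open>v\<close>; on it, the same equation is differentiated.\<close>

lemma h_n:
  assumes "w \<in> W"
  shows "h w \<bullet> n w = 0"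
proof (cases "snd w = 0")
  case True
  have "pd_v g w \<bullet> pd_v n w + pd_v (pd_v g) w \<bullet> n w = 0"
    by (rule inner_derivative_zero[OF smooth_gv smooth_n assms gv_n])
  then show ?thesis using True assms pd_v_pd_v_axis[OF open_W smooth_g smooth_h g_v] by (simp add: g_v)
next
  case False
  then show ?thesis using gv_n[OF assms] g_v[OF assms] by simp
qed

text \<open>On the singular curve \<open>(g\<^sub>u, h, n)\<close> is a positive orthonormal frame.\<close>

lemma det3_frame:
  assumes "w \<in> W" "snd w = 0"
  shows "det3 (pd_u g w) (h w) x = x \<bullet> n w"
proof -
  note axis = gu_unit[OF assms] h_unit[OF assms] gu_h[OF assms] h_n[OF assms(1)]
    gu_n[OF assms(1)] n_unit[OF assms(1)] trans[OF inner_commute gu_h[OF assms]]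
    trans[OF inner_commute h_n[OF assms(1)]] trans[OF inner_commute gu_n[OF assms(1)]]
  \<comment> \<open>The determinant squares to one, so its positivity pins it down.\<close>
  have "det3 (pd_u g w) (h w) (n w) * det3 (pd_u g w) (h w) (n w) = 1"
    unfolding det3_gram by (simp add: axis)
  then have "det3 (pd_u g w) (h w) (n w) = 1"
    using positive[OF assms] by (metis abs_of_pos abs_1 abs_mult_self_eq mult_cancel_left1
        power2_eq_square power2_eq_1_iff not_one_less_zero neg_less_0_iff_less zero_less_one less_asym)
  moreover have "det3 (pd_u g w) (h w) x * det3 (pd_u g w) (h w) (n w) = x \<bullet> n w"
    unfolding det3_gram by (simp add: axis)
  ultimately show ?thesis by simp
qed

text \<open>This is \<open>- g\<^sub>u\<^sub>v \<bullet> n\<close>, and \<open>g\<^sub>v\<close> vanishes identically along the axis.\<close>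

lemma gu_nv_axis:
  assumes "w \<in> W" "snd w = 0"
  shows "pd_u g w \<bullet> pd_v n w = 0"
proof -
  have "pd_u (pd_v g) w = pd_u (\<lambda>q. 0) w"
    using assms g_v by (intro pd_u_axis_cong[OF open_W] diff[OF smooth_gv]) auto
  then have "pd_v (pd_u g) w = 0"
    using mixed_partials[OF open_W smooth_g assms(1)] by (simp add: dirder_const)
  moreover have "pd_u g w \<bullet> pd_v n w + pd_v (pd_u g) w \<bullet> n w = 0"
    by (rule inner_derivative_zero[OF smooth_gu smooth_n assms(1) gu_n])
  ultimately show ?thesis by simp
qed

text \<open>The coefficients that remain when the powers of \<open>v\<close> are split off from the two fundamental forms.\<close>

definition "E w = pd_u g w \<bullet> pd_u g w"
definition "F w = pd_u g w \<bullet> h w"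
definition "G w = h w \<bullet> h w"
definition "L w = - (pd_u g w \<bullet> pd_u n w)"
definition "M w = - (h w \<bullet> pd_u n w)"
definition "N w = - (h w \<bullet> pd_v n w)"

lemma forms:
  assumes "w \<in> W"
  shows "form_E g w = E w" "form_F g w = snd w * F w" "form_G g w = (snd w)\<^sup>2 * G w"
    "form_L g n w = L w" "form_M g n w = snd w * M w" "form_N g n w = snd w * N w"
  by (simp_all add: form_E_def form_F_def form_G_def form_L_def form_M_def form_N_def
      E_def F_def G_def L_def M_def N_def g_v[OF assms] power2_eq_square)

lemma smooth_coefficients:
  "smooth_on W E" "smooth_on W F" "smooth_on W G" "smooth_on W L" "smooth_on W M" "smooth_on W N"
  unfolding E_def F_def G_def L_def M_def N_def
  by (intro smooth_intros open_W smooth_gu smooth_h smooth_nu smooth_nv)+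

lemma axis_values:
  assumes "w \<in> W" "snd w = 0"
  shows "E w = 1" "F w = 0" "G w = 1"
  using assms by (simp_all add: E_def F_def G_def gu_unit gu_h h_unit)

text \<open>On the axis \<open>n\<^sub>v\<close> is orthogonal to \<open>g\<^sub>u\<close> and to \<open>n\<close>, hence a multiple of \<open>h\<close>. The condition
  \<open>\<psi> = 0\<close> says that this multiple is zero, because \<open>(g\<^sub>u, h, n)\<close> is a frame.\<close>

lemma N_axis:
  assumes "w \<in> W" "snd w = 0"
  shows "N w = 0"
proof -
  note axis = gu_unit[OF assms] h_unit[OF assms] gu_h[OF assms] h_n[OF assms(1)]
    gu_n[OF assms(1)] n_unit[OF assms(1)] trans[OF inner_commute gu_h[OF assms]]
    trans[OF inner_commute h_n[OF assms(1)]] trans[OF inner_commute gu_n[OF assms(1)]]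
    gu_nv_axis[OF assms]
  have "n w \<bullet> pd_v n w + pd_v n w \<bullet> n w = 0"
    by (rule inner_derivative_zero[OF smooth_n smooth_n assms(1) n_unit])
  then have "n w \<bullet> pd_v n w = 0" by (simp add: inner_commute)
  then have "det3 (pd_u g w) (h w) (n w) * det3 (pd_u g w) (n w) (pd_v n w) = N w"
    unfolding det3_gram N_def by (simp add: axis)
  then show ?thesis using pure[OF assms] by simp
qed

definition "Nq = axis_quotient N"

lemma N_eq: "w \<in> W \<Longrightarrow> N w = snd w * Nq w"
  unfolding Nq_def by (rule axis_quotient) (rule N_axis)

lemma smooth_Nq: "smooth_on W Nq"
  unfolding Nq_def by (rule smooth_on_axis_quotient[OF open_W smooth_coefficients(6) N_axis])

text \<open>The curvature formulas after cancelling the common factor \<open>v\<^sup>2\<close>. The cancellation is possible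
  because \<open>N\<close> vanishes on the axis, and it is what extends the curvatures across the singular curve.\<close>

definition "D w = E w * G w - (F w)\<^sup>2"
definition "gauss w = (L w * Nq w - (M w)\<^sup>2) / D w"
definition "mean w = (E w * Nq w - 2 * F w * M w + G w * L w) / (2 * D w)"
definition "disc w = (mean w)\<^sup>2 - gauss w"

lemma first_form_det: "w \<in> W \<Longrightarrow> form_E g w * form_G g w - (form_F g w)\<^sup>2 = (snd w)\<^sup>2 * D w"
  by (simp add: forms D_def power2_eq_square algebra_simps)

lemma D_nonzero: "w \<in> W \<Longrightarrow> D w \<noteq> 0"
  using regular[of w] first_form_det[of w]
  by (cases "snd w = 0") (auto simp: D_def axis_values)

lemma curvatures_regular:
  assumes "w \<in> W" "snd w \<noteq> 0"
  shows "(form_L g n w * form_N g n w - (form_M g n w)\<^sup>2)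
      / (form_E g w * form_G g w - (form_F g w)\<^sup>2) = gauss w"
    and "(form_E g w * form_N g n w - 2 * form_F g w * form_M g n w + form_G g w * form_L g n w)
      / (2 * (form_E g w * form_G g w - (form_F g w)\<^sup>2)) = mean w"
proof -
  have "form_L g n w * form_N g n w - (form_M g n w)\<^sup>2 = (snd w)\<^sup>2 * (L w * Nq w - (M w)\<^sup>2)"
    using assms by (simp add: forms N_eq power2_eq_square algebra_simps)
  then show "(form_L g n w * form_N g n w - (form_M g n w)\<^sup>2)
      / (form_E g w * form_G g w - (form_F g w)\<^sup>2) = gauss w"
    using assms by (simp add: first_form_det gauss_def)
  have "form_E g w * form_N g n w - 2 * form_F g w * form_M g n w + form_G g w * form_L g n w
      = (snd w)\<^sup>2 * (E w * Nq w - 2 * F w * M w + G w * L w)"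
    using assms by (simp add: forms N_eq power2_eq_square algebra_simps)
  then show "(form_E g w * form_N g n w - 2 * form_F g w * form_M g n w + form_G g w * form_L g n w)
      / (2 * (form_E g w * form_G g w - (form_F g w)\<^sup>2)) = mean w"
    using assms by (simp add: first_form_det mean_def)
qed

lemma smooth_D: "smooth_on W D"
  unfolding D_def power2_eq_square by (intro smooth_intros open_W smooth_coefficients)

lemma smooth_gauss: "smooth_on W gauss" and smooth_mean: "smooth_on W mean"
proof -
  show "smooth_on W gauss" unfolding gauss_def power2_eq_square
    by (intro smooth_on_divide smooth_intros open_W smooth_coefficients smooth_Nq smooth_D D_nonzero)
  show "smooth_on W mean" unfolding mean_def
    by (intro smooth_on_divide smooth_intros open_W smooth_coefficients smooth_Nq smooth_D)
      (simp add: D_nonzero)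
qed

lemma smooth_disc: "smooth_on W disc"
  unfolding disc_def power2_eq_square by (intro smooth_intros open_W smooth_mean smooth_gauss)

lemma disc_axis:
  assumes "w \<in> W" "snd w = 0"
  shows "disc w = ((L w - Nq w) / 2)\<^sup>2 + (M w)\<^sup>2"
  using assms by (simp add: disc_def mean_def gauss_def D_def axis_values power2_eq_square field_simps)

definition "kmax w = mean w + sqrt (disc w)"
definition "kmin w = mean w - sqrt (disc w)"

text \<open>This is the equation \<open>det (\<kappa> I - II) = 0\<close> for the principal curvatures, divided by \<open>v\<^sup>2\<close>.\<close>

definition "characteristic \<kappa> w \<longleftrightarrow>
  (\<kappa> * E w - L w) * (\<kappa> * G w - Nq w) = (M w - \<kappa> * F w)\<^sup>2"

lemma characteristic_iff:
  assumes "w \<in> W" "disc w \<ge> 0"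
  shows "characteristic \<kappa> w \<longleftrightarrow> \<kappa> = kmax w \<or> \<kappa> = kmin w"
proof -
  have D: "D w * gauss w = L w * Nq w - (M w)\<^sup>2"
    "2 * D w * mean w = E w * Nq w - 2 * F w * M w + G w * L w"
    using D_nonzero[OF assms(1)] by (simp_all add: gauss_def mean_def)
  have "(\<kappa> * E w - L w) * (\<kappa> * G w - Nq w) - (M w - \<kappa> * F w)\<^sup>2
      = D w * \<kappa>\<^sup>2 - (2 * D w * mean w) * \<kappa> + D w * gauss w"
    unfolding D unfolding D_def by (simp add: power2_eq_square algebra_simps)
  also have "\<dots> = D w * ((\<kappa> - mean w)\<^sup>2 - disc w)"
    by (simp add: disc_def power2_eq_square algebra_simps)
  also have "\<dots> = D w * ((\<kappa> - kmax w) * (\<kappa> - kmin w))"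
    using real_sqrt_mult_self[of "disc w"] assms(2)
    by (simp add: kmax_def kmin_def power2_eq_square algebra_simps)
  finally show ?thesis using D_nonzero[OF assms(1)] by (auto simp: characteristic_def)
qed

lemma smooth_principal_curvatures:
  assumes "open S" "S \<subseteq> W" "\<And>w. w \<in> S \<Longrightarrow> disc w > 0"
  shows "smooth_on S kmax" "smooth_on S kmin"
proof -
  have "smooth_on S mean" "smooth_on S (\<lambda>w. sqrt (disc w))"
    using assms smooth_mean smooth_disc by (auto intro: smooth_on_sqrt smooth_on_subset)
  then show "smooth_on S kmax" "smooth_on S kmin"
    unfolding kmax_def kmin_def using assms(1) by (auto intro: smooth_on_add smooth_on_diff)
qed

lemma principal_field_eq:
  "principal_field g n h \<kappa> w = (- snd w * (M w - \<kappa> w * F w), L w - \<kappa> w * E w)"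
  by (simp add: principal_field_def E_def F_def L_def M_def Let_def)

lemma smooth_principal_field:
  assumes "open S" "S \<subseteq> W" "smooth_on S \<kappa>"
  shows "smooth_on S (principal_field g n h \<kappa>)"
  unfolding principal_field_eq[abs_def]
  by (intro smooth_intros assms smooth_on_subset[OF smooth_coefficients(1)]
      smooth_on_subset[OF smooth_coefficients(2)] smooth_on_subset[OF smooth_coefficients(4)]
      smooth_on_subset[OF smooth_coefficients(5)])

text \<open>Without torsion both \<open>M\<close> and \<open>F\<close> are multiples of \<open>v\<close>. The principal field of the curvature
  that agrees with \<open>L\<close> at the origin vanishes there; dividing the second row of
  \<open>(\<kappa> I - II) X = 0\<close> by \<open>v\<^sup>2\<close> gives a field \<open>X\<close> of the same direction that does not vanish:
  at the origin its first component is the difference of the two principal curvatures. The other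
  principal field points along \<open>\<partial>\<^sub>v\<close> there, so the two are independent.\<close>

lemma principal_frame:
  assumes M0: "\<And>w. w \<in> W \<Longrightarrow> snd w = 0 \<Longrightarrow> M w = 0"
    and S: "open S" "0 \<in> S" "S \<subseteq> W"
    and \<kappa>: "smooth_on S \<kappa>" "smooth_on S \<kappa>'"
    and char: "\<And>w. w \<in> S \<Longrightarrow> characteristic (\<kappa> w) w" "\<And>w. w \<in> S \<Longrightarrow> characteristic (\<kappa>' w) w"
    and "\<kappa> 0 = L 0" "\<kappa>' 0 \<noteq> L 0"
  obtains T X where "open T" "0 \<in> T" "T \<subseteq> S" "smooth_on T X"
    "\<And>w. w \<in> T \<Longrightarrow> det2 (X w) (principal_field g n h \<kappa>' w) \<noteq> 0"
    "\<And>w. w \<in> T \<Longrightarrow> det2 (principal_field g n h \<kappa> w) (X w) = 0"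
proof -
  define Mq where "Mq = axis_quotient M"
  define Fq where "Fq = axis_quotient F"
  have M: "M w = snd w * Mq w" and F: "F w = snd w * Fq w" if "w \<in> W" for w
    unfolding Mq_def Fq_def
    by (rule axis_quotient, use M0 axis_values(2) that in blast)+
  have sq: "smooth_on S Mq" "smooth_on S Fq"
    unfolding Mq_def Fq_def
    by (auto intro!: smooth_on_subset[OF _ S(3)] smooth_on_axis_quotient open_W
        smooth_coefficients M0 axis_values)
  define X where "X w = (Nq w - \<kappa> w * G w, - (Mq w - \<kappa> w * Fq w))" for w
  have sX: "smooth_on S X" unfolding X_def[abs_def]
    by (intro smooth_intros S \<kappa> sq smooth_on_subset[OF smooth_Nq S(3)]
        smooth_on_subset[OF smooth_coefficients(3) S(3)])
  have dX: "det2 (principal_field g n h \<kappa> w) (X w) = 0" if "w \<in> S" for w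
  proof -
    have w: "w \<in> W" using S that by blast
    have "det2 (principal_field g n h \<kappa> w) (X w)
        = (M w - \<kappa> w * F w)\<^sup>2 - (\<kappa> w * E w - L w) * (\<kappa> w * G w - Nq w)"
      unfolding principal_field_eq X_def det2_def M[OF w] F[OF w]
      by (simp add: power2_eq_square algebra_simps)
    then show ?thesis using char(1)[OF that] by (simp add: characteristic_def)
  qed
  let ?d = "\<lambda>w. det2 (X w) (principal_field g n h \<kappa>' w)"
  have "0 \<in> W" using S by blast
  then have ax: "E 0 = 1" "F 0 = 0" "G 0 = 1" "M 0 = 0" using axis_values[of 0] M0[of 0] by auto
  have "(\<kappa>' 0 - L 0) * (\<kappa>' 0 - Nq 0) = 0"
    using char(2)[OF S(2)] by (simp add: characteristic_def ax)
  then have "Nq 0 = \<kappa>' 0" using assms(10) by simp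
  then have d0: "?d 0 \<noteq> 0" using assms(9,10) by (simp add: det2_def X_def principal_field_eq ax)
  have "continuous_on S ?d"
  proof (rule smooth_on_imp_continuous_on)
    have "smooth_on S (\<lambda>w. (X w \<bullet> (1, 0)) * (principal_field g n h \<kappa>' w \<bullet> (0, 1))
        - (X w \<bullet> (0, 1)) * (principal_field g n h \<kappa>' w \<bullet> (1, 0)))"
      by (intro smooth_intros S sX smooth_principal_field \<kappa>)
    then show "smooth_on S ?d" by (simp add: det2_def inner_prod_def)
  qed
  then have "open (S \<inter> ?d -` (- {0}))"
    using S(1) by (intro continuous_open_preimage) auto
  moreover have "smooth_on (S \<inter> ?d -` (- {0})) X" using sX smooth_on_subset by blast
  ultimately show ?thesis
    using that[of "S \<inter> ?d -` (- {0})" X] d0 S(2) dX by auto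
qed

text \<open>With \<open>X = a \<partial>\<^sub>u\<close> and \<open>Y = d \<partial>\<^sub>v\<close> on the axis, where \<open>c\<close> is the first component of \<open>Y\<close>, the second
  derivative of \<open>g\<close> along \<open>Y\<close> is \<open>d c\<^sub>v g\<^sub>u + d\<^sup>2 h\<close>. The torsion
  therefore reduces to \<open>det (g\<^sub>u, h, h\<^sub>u) = h\<^sub>u \<bullet> n = - h \<bullet> n\<^sub>u\<close> for every adapted pair.\<close>

lemma cuspidal_torsion_chart:
  assumes X: "smooth_on W X" "\<And>q. q \<in> W \<Longrightarrow> snd q = 0 \<Longrightarrow> snd (X q) = 0"
    and Y: "smooth_on W Y" "\<And>q. q \<in> W \<Longrightarrow> snd q = 0 \<Longrightarrow> fst (Y q) = 0"
    and w: "w \<in> W" "snd w = 0" "fst (X w) \<noteq> 0" "snd (Y w) \<noteq> 0"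
  shows "cuspidal_torsion g X Y w = M w"
proof -
  define a where "a = (\<lambda>q. X q \<bullet> (1, 0))"
  define c where "c = (\<lambda>q. Y q \<bullet> (1, 0))"
  define d where "d = (\<lambda>q. Y q \<bullet> (0, 1))"
  have s: "smooth_on W a" "smooth_on W c" "smooth_on W d"
    unfolding a_def c_def d_def by (intro smooth_intros open_W X Y)+
  have comp: "fst (X q) = a q" "fst (Y q) = c q" "snd (Y q) = d q" for q
    by (simp_all add: a_def c_def d_def inner_prod_def)
  note gu = smooth_gu and gv = smooth_gv
  have sP: "smooth_on W (dirder Y g)" by (rule smooth_on_dirder[OF open_W smooth_g Y(1)])
  have sQ: "smooth_on W (dirder Y (dirder Y g))" by (rule smooth_on_dirder[OF open_W sP Y(1)])
  have sR: "smooth_on W (dirder X g)" by (rule smooth_on_dirder[OF open_W smooth_g X(1)])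
  have Xg: "dirder X g q = a q *\<^sub>R pd_u g q" if "q \<in> W" "snd q = 0" for q
    using that by (simp add: dirder_plane[OF diff[OF smooth_g that(1)], of X] comp X g_v)
  define \<alpha> where "\<alpha> = (\<lambda>q. d q * pd_v c q)"
  define \<beta> where "\<beta> = (\<lambda>q. d q * d q)"
  have s\<alpha>: "smooth_on W \<alpha>" and s\<beta>: "smooth_on W \<beta>"
    unfolding \<alpha>_def \<beta>_def by (intro smooth_intros open_W s smooth_on_pd)+
  have YYg: "dirder Y (dirder Y g) q = \<alpha> q *\<^sub>R pd_u g q + \<beta> q *\<^sub>R h q" if q: "q \<in> W" "snd q = 0" for q
  proof -
    let ?P = "\<lambda>q. c q *\<^sub>R pd_u g q + d q *\<^sub>R (snd q *\<^sub>R h q)"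
    have "pd_v (dirder Y g) q = pd_v ?P q"
      using q by (intro dirder_cong[OF open_W] diff[OF sP])
        (simp_all add: dirder_plane[OF diff[OF smooth_g], of _ Y] comp g_v)
    also have "\<dots> = pd_v (\<lambda>q. c q *\<^sub>R pd_u g q) q + pd_v (\<lambda>q. d q *\<^sub>R (snd q *\<^sub>R h q)) q"
      by (intro dirder_add diff[OF _ q(1)] smooth_intros open_W s gu smooth_h)
    also have "pd_v (\<lambda>q. c q *\<^sub>R pd_u g q) q = pd_v c q *\<^sub>R pd_u g q"
      using dirder_scaleR[OF diff[OF s(2) q(1)] diff[OF gu q(1)]] Y(2)[OF q] comp by simp
    also have "pd_v (\<lambda>q. d q *\<^sub>R (snd q *\<^sub>R h q)) q = d q *\<^sub>R h q"
    proof -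
      have "smooth_on W (\<lambda>q. snd q *\<^sub>R h q)" by (intro smooth_intros open_W smooth_h)
      from dirder_scaleR[OF diff[OF s(3) q(1)] diff[OF this q(1)]]
        dirder_scaleR[OF diff[OF smooth_on_snd q(1)] diff[OF smooth_h q(1)]]
      show ?thesis using q(2) by (simp add: dirder_snd)
    qed
    finally have "pd_v (dirder Y g) q = pd_v c q *\<^sub>R pd_u g q + d q *\<^sub>R h q" .
    then show ?thesis
      using dirder_plane[OF diff[OF sP q(1)], of Y] Y(2)[OF q]
      by (simp add: comp \<alpha>_def \<beta>_def scaleR_add_right)
  qed
  have XYYg: "dirder X (dirder Y (dirder Y g)) w = a w *\<^sub>R (\<alpha> w *\<^sub>R pd_u (pd_u g) w
      + pd_u \<alpha> w *\<^sub>R pd_u g w + \<beta> w *\<^sub>R pd_u h w + pd_u \<beta> w *\<^sub>R h w)"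
  proof -
    have s1: "smooth_on W (\<lambda>q. \<alpha> q *\<^sub>R pd_u g q)" and s2: "smooth_on W (\<lambda>q. \<beta> q *\<^sub>R h q)"
      by (intro smooth_intros open_W s\<alpha> s\<beta> gu smooth_h)+
    have "pd_u (dirder Y (dirder Y g)) w = pd_u (\<lambda>q. \<alpha> q *\<^sub>R pd_u g q + \<beta> q *\<^sub>R h q) w"
      by (rule pd_u_axis_cong[OF open_W w(1,2) diff[OF sQ w(1)]
            diff[OF smooth_on_add[OF open_W s1 s2] w(1)]]) (rule YYg)
    then show ?thesis
      using dirder_plane[OF diff[OF sQ w(1)], of X] X(2)[OF w(1,2)]
        dirder_add[OF diff[OF s1 w(1)] diff[OF s2 w(1)]]
        dirder_scaleR[OF diff[OF s\<alpha> w(1)] diff[OF gu w(1)]]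
        dirder_scaleR[OF diff[OF s\<beta> w(1)] diff[OF smooth_h w(1)]]
      by (simp add: comp)
  qed
  have XXg: "dirder X (dirder X g) w = a w *\<^sub>R (a w *\<^sub>R pd_u (pd_u g) w + pd_u a w *\<^sub>R pd_u g w)"
  proof -
    have "smooth_on W (\<lambda>q. a q *\<^sub>R pd_u g q)" by (intro smooth_intros open_W s gu)
    then have "pd_u (dirder X g) w = pd_u (\<lambda>q. a q *\<^sub>R pd_u g q) w"
      by (intro pd_u_axis_cong[OF open_W w(1,2) diff[OF sR w(1)]] Xg) (auto intro: diff w(1))
    then show ?thesis
      using dirder_plane[OF diff[OF sR w(1)], of X] X(2)[OF w(1,2)]
        dirder_scaleR[OF diff[OF s(1) w(1)] diff[OF gu w(1)]]
      by (simp add: comp)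
  qed
  have "cuspidal_torsion g X Y w = det3 (pd_u g w) (h w) (pd_u h w)"
    unfolding cuspidal_torsion_def Let_def
    by (rule torsion_quotient[OF gu_unit[OF w(1,2)] h_unit[OF w(1,2)] gu_h[OF w(1,2)] _ _
          Xg[OF w(1,2)] YYg[OF w(1,2)] XYYg XXg]) (use w(3,4) in \<open>simp_all add: comp \<beta>_def\<close>)
  also have "\<dots> = pd_u h w \<bullet> n w" by (rule det3_frame[OF w(1,2)])
  also have "\<dots> = M w"
    using inner_derivative_zero[OF smooth_h smooth_n w(1) h_n, of "\<lambda>_. (1, 0)"]
    by (simp add: M_def)
  finally show ?thesis .
qed

text \<open>On the axis the characteristic equation reads \<open>(\<kappa> - L) (\<kappa> - N') = M\<^sup>2\<close>, where \<open>N'\<close> is the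
  extension of \<open>N / v\<close>.\<close>

lemma principal_curvature_axis:
  assumes "w \<in> W" "snd w = 0"
  shows "L w = kmax w \<or> L w = kmin w \<longleftrightarrow> M w = 0"
proof -
  have "disc w \<ge> 0" using disc_axis[OF assms] by simp
  from characteristic_iff[OF assms(1) this, of "L w"] show ?thesis
    using axis_values[OF assms] by (auto simp: characteristic_def)
qed

end

section \<open>Change of coordinates\<close>

text \<open>The squared norm of \<open>G g\<^sub>u - F g\<^sub>v\<close> is \<open>G (E G - F\<^sup>2)\<close>, so if the determinant
  vanishes, either \<open>(G, - F)\<close> is a kernel vector of the differential or \<open>g\<^sub>v = 0\<close>.\<close>

lemma inj_imp_first_form_det:
  assumes "g differentiable (at w)" "inj (frechet_derivative g (at w))"
  shows "form_E g w * form_G g w - (form_F g w)\<^sup>2 \<noteq> 0"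
proof
  let ?A = "frechet_derivative g (at w)"
  assume 0: "form_E g w * form_G g w - (form_F g w)\<^sup>2 = 0"
  have A: "?A X = fst X *\<^sub>R pd_u g w + snd X *\<^sub>R pd_v g w" for X
    by (rule frechet_derivative_plane[OF assms(1)])
  have "?A (form_G g w, - form_F g w) \<bullet> ?A (form_G g w, - form_F g w)
      = form_G g w * (form_E g w * form_G g w - (form_F g w)\<^sup>2)"
    unfolding A by (simp add: form_E_def form_F_def form_G_def inner_simps inner_commute
        power2_eq_square algebra_simps)
  then have "?A (form_G g w, - form_F g w) = 0" using 0 by simp
  moreover have "?A 0 = 0" by (simp add: A)
  ultimately have "form_G g w = 0" using assms(2) by (metis Pair_inject injD zero_prod_def)
  then have "?A (0, 1) = 0" by (simp add: A form_G_def)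
  then show False using assms(2) \<open>?A 0 = 0\<close> by (metis Pair_inject injD zero_neq_one zero_prod_def)
qed

lemma unit_normalD:
  "unit_normal_on V f \<nu> \<Longrightarrow> q \<in> V \<Longrightarrow> frechet_derivative f (at q) X \<bullet> \<nu> q = 0"
  unfolding unit_normal_on_def by blast

lemma second_form_symmetric:
  assumes "open V" "smooth_on V f" "unit_normal_on V f \<nu>" "q \<in> V"
  shows "pd_u f q \<bullet> pd_v \<nu> q = pd_v f q \<bullet> pd_u \<nu> q"
proof -
  have \<nu>: "smooth_on V \<nu>" and 0: "dirder (\<lambda>_. e) f x \<bullet> \<nu> x = 0" if "x \<in> V" for e x
    using assms(3) that unfolding unit_normal_on_def dirder_def by blast+
  note diff = smooth_on_imp_differentiable[OF _ assms(4)]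
  have "dirder (\<lambda>_. e) f q \<bullet> dirder (\<lambda>_. e') \<nu> q + dirder (\<lambda>_. e') (dirder (\<lambda>_. e) f) q \<bullet> \<nu> q = 0" for e e'
  proof -
    have "dirder (\<lambda>_. e') (\<lambda>q. dirder (\<lambda>_. e) f q \<bullet> \<nu> q) q = dirder (\<lambda>_. e') (\<lambda>q. 0) q"
      using 0 assms \<nu> by (intro dirder_cong[OF assms(1,4)] diff smooth_on_inner smooth_on_pd) auto
    then show ?thesis
      using dirder_inner[OF diff[OF smooth_on_pd[OF assms(2)]] diff[OF \<nu>[OF assms(4)]]]
      by (simp add: dirder_const)
  qed
  from this[of "(1, 0)" "(0, 1)"] this[of "(0, 1)" "(1, 0)"] show ?thesis
    using mixed_partials[OF assms(1,2,4)] by simp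
qed

text \<open>A form that shows no coordinates: it makes the notion transferable along \<open>\<phi>\<close>.\<close>

lemma principal_vector_iff:
  assumes "open V" "smooth_on V f" "unit_normal_on V f \<nu>" "q \<in> V"
  shows "principal_vector f \<nu> \<kappa> q X \<longleftrightarrow> (\<forall>Y. frechet_derivative f (at q) Y \<bullet>
    (\<kappa> *\<^sub>R frechet_derivative f (at q) X + frechet_derivative \<nu> (at q) X) = 0)"
proof -
  have "smooth_on V \<nu>" using assms(3) by (simp add: unit_normal_on_def)
  then have d: "frechet_derivative f (at q) Y = fst Y *\<^sub>R pd_u f q + snd Y *\<^sub>R pd_v f q"
    "frechet_derivative \<nu> (at q) Y = fst Y *\<^sub>R pd_u \<nu> q + snd Y *\<^sub>R pd_v \<nu> q" for Y
    using assms by (auto intro!: frechet_derivative_plane smooth_on_imp_differentiable)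
  let ?Z = "\<kappa> *\<^sub>R frechet_derivative f (at q) X + frechet_derivative \<nu> (at q) X"
  have "principal_vector f \<nu> \<kappa> q X \<longleftrightarrow> pd_u f q \<bullet> ?Z = 0 \<and> pd_v f q \<bullet> ?Z = 0"
    unfolding principal_vector_def d form_E_def form_F_def form_G_def form_L_def form_M_def form_N_def
    using second_form_symmetric[OF assms]
    by (simp add: inner_simps inner_commute algebra_simps eq_neg_iff_add_eq_0)
  also have "\<dots> \<longleftrightarrow> (\<forall>Y. frechet_derivative f (at q) Y \<bullet> ?Z = 0)"
  proof
    assume "pd_u f q \<bullet> ?Z = 0 \<and> pd_v f q \<bullet> ?Z = 0"
    then show "\<forall>Y. frechet_derivative f (at q) Y \<bullet> ?Z = 0"
      unfolding d(1)[of "Y" for Y] by (simp add: inner_add_left)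
  next
    assume "\<forall>Y. frechet_derivative f (at q) Y \<bullet> ?Z = 0"
    then show "pd_u f q \<bullet> ?Z = 0 \<and> pd_v f q \<bullet> ?Z = 0" by (simp add: dirder_def)
  qed
  finally show ?thesis .
qed

text \<open>A pure-frontal singular point together with orthogonal adapted coordinates; the rest of the
  section reduces it to the situation of the previous one for \<open>f \<circ> \<phi>\<close> and \<open>\<nu> \<circ> \<phi>\<close>.\<close>

locale orthogonal_frontal_chart =
  fixes V U W :: "plane set" and f \<nu> h :: "plane \<Rightarrow> real^3" and p :: plane and \<epsilon> :: real
    and \<gamma> :: "real \<Rightarrow> plane" and \<phi> \<theta> :: "plane \<Rightarrow> plane"
  assumes frontal: "frontal V f" and unit_normal: "unit_normal_on V f \<nu>"
    and pure_frontal: "pure_frontal V f \<nu> p U \<epsilon> \<gamma>"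
    and coordinates: "orthogonal_adapted_coordinates V f U \<epsilon> \<gamma> W \<phi> \<theta>"
    and det_pos: "w \<in> W \<Longrightarrow> snd w = 0 \<Longrightarrow>
      det3 (pd_u (f \<circ> \<phi>) w) (pd_v (pd_v (f \<circ> \<phi>)) w) ((\<nu> \<circ> \<phi>) w) > 0"
    and smooth_h: "smooth_on W h"
    and g_v: "w \<in> W \<Longrightarrow> pd_v (f \<circ> \<phi>) w = snd w *\<^sub>R h w"
begin

abbreviation "D\<phi> w \<equiv> frechet_derivative \<phi> (at w)"

lemma open_V: "open V" and smooth_f: "smooth_on V f" and smooth_\<nu>: "smooth_on V \<nu>"
  using frontal unit_normal by (auto simp: frontal_def unit_normal_on_def)

lemma chart: "open W" "open U" "smooth_on W \<phi>" "smooth_on U \<theta>" "\<phi> ` W = U" "w \<in> W \<Longrightarrow> \<theta> (\<phi> w) = w"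
  using coordinates
  by (auto simp: orthogonal_adapted_coordinates_def adapted_coordinates_def coordinate_system_def)

lemma curve: "U \<subseteq> V" "smooth_on {-\<epsilon><..<\<epsilon>} \<gamma>" "t \<in> {-\<epsilon><..<\<epsilon>} \<Longrightarrow> velocity \<gamma> t \<noteq> 0"
  "\<gamma> ` {-\<epsilon><..<\<epsilon>} = sing_set V f \<inter> U"
  using pure_frontal by (auto simp: pure_frontal_def first_kind_def singular_curve_def)

lemma axis_image: "\<phi> ` {w \<in> W. snd w = 0} = \<gamma> ` {-\<epsilon><..<\<epsilon>}"
  using coordinates by (auto simp: orthogonal_adapted_coordinates_def adapted_coordinates_def)

lemma in_chart: "w \<in> W \<Longrightarrow> \<phi> w \<in> U" "w \<in> W \<Longrightarrow> \<phi> w \<in> V"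
  using chart(5) curve(1) by auto

lemma \<theta>: "q \<in> U \<Longrightarrow> \<theta> q \<in> W" "q \<in> U \<Longrightarrow> \<phi> (\<theta> q) = q"
  using chart(5,6) by auto

lemma singular_iff:
  assumes "w \<in> W"
  shows "\<phi> w \<in> sing_set V f \<longleftrightarrow> snd w = 0"
proof -
  have "\<phi> w \<in> sing_set V f \<longleftrightarrow> \<phi> w \<in> \<phi> ` {w \<in> W. snd w = 0}"
    unfolding axis_image curve(4) using in_chart(1)[OF assms] by simp
  also have "\<dots> \<longleftrightarrow> snd w = 0" using chart(6) assms by (metis (mono_tags, lifting) image_iff mem_Collect_eq)
  finally show ?thesis .
qed

lemma \<phi>_differentiable: "w \<in> W \<Longrightarrow> \<phi> differentiable (at w)"
  and \<theta>_differentiable: "w \<in> W \<Longrightarrow> \<theta> differentiable (at (\<phi> w))"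
  using chart(3,4) in_chart smooth_on_imp_differentiable by blast+

lemma linear_D\<phi>: "w \<in> W \<Longrightarrow> linear (D\<phi> w)"
  by (intro linear_frechet_derivative \<phi>_differentiable)

lemma D\<theta>_D\<phi>:
  assumes "w \<in> W"
  shows "frechet_derivative \<theta> (at (\<phi> w)) (D\<phi> w X) = X"
proof -
  have "frechet_derivative (\<theta> \<circ> \<phi>) (at w) = frechet_derivative (\<lambda>x. x) (at w)"
    using assms chart \<phi>_differentiable \<theta>_differentiable
    by (intro frechet_derivative_transform_within_open[of _ _ W] differentiable_chain_at) auto
  then show ?thesis
    using frechet_derivative_compose[OF \<phi>_differentiable \<theta>_differentiable, OF assms assms]
    by (metis comp_apply frechet_derivative_ident)
qed

lemma D\<phi>_D\<theta>:
  assumes "w \<in> W"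
  shows "D\<phi> w (frechet_derivative \<theta> (at (\<phi> w)) Y) = Y"
proof -
  have \<phi>: "\<phi> differentiable (at (\<theta> (\<phi> w)))" using assms chart(6) \<phi>_differentiable by simp
  have "frechet_derivative (\<phi> \<circ> \<theta>) (at (\<phi> w)) = frechet_derivative (\<lambda>x. x) (at (\<phi> w))"
    using assms chart(2) \<theta> in_chart \<phi> \<theta>_differentiable
    by (intro frechet_derivative_transform_within_open[of _ _ U] differentiable_chain_at) auto
  then show ?thesis
    using frechet_derivative_compose[OF \<theta>_differentiable[OF assms] \<phi>] chart(6)[OF assms]
    by (metis comp_apply frechet_derivative_ident)
qed

lemma derivative_compose:
  assumes "smooth_on V F" "w \<in> W"
  shows "frechet_derivative (F \<circ> \<phi>) (at w) X = frechet_derivative F (at (\<phi> w)) (D\<phi> w X)"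
  using frechet_derivative_compose[OF \<phi>_differentiable
      smooth_on_imp_differentiable[OF assms(1)], of w] in_chart assms(2) by simp

lemma smooth_compose: "smooth_on V F \<Longrightarrow> smooth_on W (F \<circ> \<phi>)" for F :: "plane \<Rightarrow> real^3"
  using smooth_on_compose[OF chart(1) open_V _ _ chart(3)] in_chart by (metis image_subsetI)

lemma jacobian: "w \<in> W \<Longrightarrow> det2 (D\<phi> w (1, 0)) (D\<phi> w (0, 1)) > 0"
  using coordinates in_chart(1)[of w] chart(6)[of w]
  by (auto simp: orthogonal_adapted_coordinates_def adapted_coordinates_def adapted_pair_def
      coord_field_def)

text \<open>The second coordinate of \<open>\<theta> \<circ> \<gamma>\<close> is constantly zero, so \<open>\<gamma>'\<close> is a multiple of \<open>\<partial>\<^sub>u\<close>.\<close>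

lemma curve_in_chart:
  assumes t: "t \<in> {-\<epsilon><..<\<epsilon>}"
  obtains w s where "w \<in> W" "snd w = 0" "\<gamma> t = \<phi> w" "s \<noteq> 0" "velocity \<gamma> t = D\<phi> w (s, 0)"
proof -
  have ax: "\<exists>w. w \<in> W \<and> snd w = 0 \<and> \<gamma> r = \<phi> w" if "r \<in> {-\<epsilon><..<\<epsilon>}" for r
    using axis_image that by (smt (verit) image_iff mem_Collect_eq)
  obtain w where w: "w \<in> W" "snd w = 0" "\<gamma> t = \<phi> w" using ax[OF t] by blast
  have \<gamma>: "(\<gamma> has_vector_derivative velocity \<gamma> t) (at t)"
    using smooth_on_imp_differentiable[OF curve(2) t] vector_derivative_works by blast
  let ?A = "frechet_derivative \<theta> (at (\<phi> w))"
  have "((\<theta> \<circ> \<gamma>) has_vector_derivative ?A (velocity \<gamma> t)) (at t)"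
    using vector_derivative_diff_chain_within[of \<gamma> "velocity \<gamma> t" t UNIV \<theta> ?A] \<gamma> w
      has_derivative_at_withinI[of \<theta> ?A "\<gamma> t"] \<theta>_differentiable[OF w(1)] frechet_derivative_works
    by auto
  then have "((\<lambda>r. snd ((\<theta> \<circ> \<gamma>) r)) has_vector_derivative snd (?A (velocity \<gamma> t))) (at t)"
    by (rule bounded_linear.has_vector_derivative[OF bounded_linear_snd])
  moreover have "((\<lambda>r. snd ((\<theta> \<circ> \<gamma>) r)) has_vector_derivative 0) (at t)"
  proof (rule has_vector_derivative_transform_within_open[OF has_vector_derivative_const _ t])
    show "0 = snd ((\<theta> \<circ> \<gamma>) r)" if "r \<in> {-\<epsilon><..<\<epsilon>}" for r
      using ax[OF that] chart(6) by auto
  qed auto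
  ultimately have "snd (?A (velocity \<gamma> t)) = 0" using vector_derivative_unique_at by blast
  then have v: "velocity \<gamma> t = D\<phi> w (fst (?A (velocity \<gamma> t)), 0)"
    using D\<phi>_D\<theta>[OF w(1), of "velocity \<gamma> t"] by (metis prod.collapse)
  have "fst (?A (velocity \<gamma> t)) \<noteq> 0"
    using curve(3)[OF t] v linear_0[OF linear_D\<phi>[OF w(1)]] by (auto simp: zero_prod_def)
  then show ?thesis using that w v by blast
qed

lemma axis_in_curve:
  assumes "w \<in> W" "snd w = 0"
  obtains t where "t \<in> {-\<epsilon><..<\<epsilon>}" "\<gamma> t = \<phi> w"
  using assms axis_image by (smt (verit) image_iff mem_Collect_eq)

lemma velocity_compose:
  assumes "t \<in> {-\<epsilon><..<\<epsilon>}"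
  shows "velocity (f \<circ> \<gamma>) t = frechet_derivative f (at (\<gamma> t)) (velocity \<gamma> t)"
proof -
  have "\<gamma> t \<in> V" using curve(1,4) assms by blast
  then have "(f has_derivative frechet_derivative f (at (\<gamma> t))) (at (\<gamma> t) within \<gamma> ` UNIV)"
    using has_derivative_frechet[OF smooth_f] has_derivative_at_withinI by blast
  moreover have "(\<gamma> has_vector_derivative velocity \<gamma> t) (at t)"
    using smooth_on_imp_differentiable[OF curve(2) assms] vector_derivative_works by blast
  ultimately show ?thesis
    using vector_derivative_diff_chain_within[of \<gamma> "velocity \<gamma> t" t UNIV f] vector_derivative_at
    by blast
qed

lemma gu_unit:
  assumes "w \<in> W" "snd w = 0"
  shows "pd_u (f \<circ> \<phi>) w \<bullet> pd_u (f \<circ> \<phi>) w = 1"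
  using coordinates assms by (simp add: orthogonal_adapted_coordinates_def norm_eq_1)

text \<open>On the axis \<open>g\<^sub>v = 0\<close> and \<open>g\<^sub>u \<noteq> 0\<close>, so the kernel of the differential is spanned by \<open>\<partial>\<^sub>v\<close>.\<close>

lemma null_direction:
  assumes "w \<in> W" "snd w = 0" "frechet_derivative f (at (\<phi> w)) Y = 0"
  shows "Y = D\<phi> w (0, snd (frechet_derivative \<theta> (at (\<phi> w)) Y))"
proof -
  let ?Z = "frechet_derivative \<theta> (at (\<phi> w)) Y"
  have "frechet_derivative (f \<circ> \<phi>) (at w) ?Z = 0"
    using derivative_compose[OF smooth_f assms(1)] D\<phi>_D\<theta>[OF assms(1)] assms(3) by simp
  then have "fst ?Z *\<^sub>R pd_u (f \<circ> \<phi>) w = 0"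
    using frechet_derivative_plane[OF smooth_on_imp_differentiable[OF smooth_compose[OF smooth_f]
          assms(1)], of ?Z] g_v[OF assms(1)] assms(2) by simp
  then have "fst ?Z = 0" using gu_unit[OF assms(1,2)] by auto
  then show ?thesis using D\<phi>_D\<theta>[OF assms(1), of Y] by (metis prod.collapse)
qed

lemma null_field:
  assumes "null_vector_field V f U \<eta>" "w \<in> W" "snd w = 0"
  obtains d where "d \<noteq> 0" "\<eta> (\<phi> w) = D\<phi> w (0, d)"
proof -
  have 0: "frechet_derivative f (at (\<phi> w)) (\<eta> (\<phi> w)) = 0"
    using assms singular_iff in_chart by (auto simp: null_vector_field_def dirder_def)
  have nz: "\<eta> (\<phi> w) \<noteq> 0" using assms in_chart by (auto simp: null_vector_field_def)
  let ?d = "snd (frechet_derivative \<theta> (at (\<phi> w)) (\<eta> (\<phi> w)))"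
  have eq: "\<eta> (\<phi> w) = D\<phi> w (0, ?d)" by (rule null_direction[OF assms(2,3) 0])
  then have "?d \<noteq> 0" using nz linear_0[OF linear_D\<phi>[OF assms(2)]] by (metis zero_prod_def)
  then show ?thesis using that eq by blast
qed

lemma pd_scale: "D\<phi> w (s, 0) = s *\<^sub>R D\<phi> w (1, 0)" "D\<phi> w (0, s) = s *\<^sub>R D\<phi> w (0, 1)" if "w \<in> W"
  using linear_scale[OF linear_D\<phi>[OF that]] by (metis mult.right_neutral mult_zero_right
      real_scaleR_def scaleR_Pair)+

lemma derivative_along:
  fixes F :: "plane \<Rightarrow> real^3"
  assumes "smooth_on V F" "w \<in> W"
  shows "frechet_derivative F (at (\<phi> w)) (D\<phi> w X) = fst X *\<^sub>R pd_u (F \<circ> \<phi>) w + snd X *\<^sub>R pd_v (F \<circ> \<phi>) w"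
  using derivative_compose[OF assms] frechet_derivative_plane[OF
      smooth_on_imp_differentiable[OF smooth_compose[OF assms(1)] assms(2)]] by metis

sublocale pure_frontal_chart W "f \<circ> \<phi>" "\<nu> \<circ> \<phi>" h
proof
  let ?g = "f \<circ> \<phi>" and ?n = "\<nu> \<circ> \<phi>"
  show "open W" "smooth_on W ?g" "smooth_on W ?n" "smooth_on W h"
    using chart(1) smooth_compose smooth_f smooth_\<nu> smooth_h by auto
  fix w assume w: "w \<in> W"
  show "pd_v ?g w = snd w *\<^sub>R h w" by (rule g_v[OF w])
  show "?n w \<bullet> ?n w = 1"
    using unit_normal in_chart(2)[OF w] by (auto simp: unit_normal_on_def norm_eq_1)
  have "dirder (\<lambda>_. e) ?g w \<bullet> ?n w = 0" for e
    using unit_normalD[OF unit_normal in_chart(2)[OF w]]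
    by (simp add: dirder_def derivative_compose[OF smooth_f w])
  then show "pd_u ?g w \<bullet> ?n w = 0" "pd_v ?g w \<bullet> ?n w = 0" by blast+
  show "form_E ?g w * form_G ?g w - (form_F ?g w)\<^sup>2 \<noteq> 0" if "snd w \<noteq> 0"
  proof (rule inj_imp_first_form_det)
    show "?g differentiable (at w)"
      by (rule smooth_on_imp_differentiable[OF smooth_compose[OF smooth_f] w])
    have "inj (frechet_derivative f (at (\<phi> w)))"
      using singular_iff[OF w] in_chart(2)[OF w] that by (simp add: sing_set_def)
    then show "inj (frechet_derivative ?g (at w))"
      using derivative_compose[OF smooth_f w] D\<theta>_D\<phi>[OF w] by (metis (no_types, lifting) injD injI)
  qed
  assume ax: "snd w = 0"
  have gvv: "pd_v (pd_v ?g) w = h w"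
    using pd_v_pd_v_axis[OF chart(1) smooth_compose[OF smooth_f] smooth_h g_v w ax] .
  show "pd_u ?g w \<bullet> pd_u ?g w = 1" by (rule gu_unit[OF w ax])
  show "h w \<bullet> h w = 1" "pd_u ?g w \<bullet> h w = 0"
    using coordinates w ax gvv by (auto simp: orthogonal_adapted_coordinates_def norm_eq_1)
  show "det3 (pd_u ?g w) (h w) (?n w) > 0" using det_pos[OF w ax] gvv by simp
  obtain \<eta> where \<eta>: "null_vector_field V f U \<eta>" "\<And>t. t \<in> {-\<epsilon><..<\<epsilon>} \<Longrightarrow> psi f \<nu> \<gamma> \<eta> t = 0"
    using pure_frontal by (auto simp: pure_frontal_def)
  obtain t where t: "t \<in> {-\<epsilon><..<\<epsilon>}" "\<gamma> t = \<phi> w" using axis_in_curve[OF w ax] .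
  obtain w' s where w': "w' \<in> W" "\<gamma> t = \<phi> w'" "s \<noteq> 0" "velocity \<gamma> t = D\<phi> w' (s, 0)"
    using curve_in_chart[OF t(1)] by metis
  have "w' = w" using chart(6) w w'(1,2) t(2) by metis
  then have 1: "velocity (f \<circ> \<gamma>) t = s *\<^sub>R pd_u ?g w"
    using velocity_compose[OF t(1)] w' derivative_along[OF smooth_f w] by simp
  obtain d where d: "d \<noteq> 0" "\<eta> (\<phi> w) = D\<phi> w (0, d)" using null_field[OF \<eta>(1) w ax] .
  then have 2: "dirder \<eta> \<nu> (\<phi> w) = d *\<^sub>R pd_v ?n w"
    using derivative_along[OF smooth_\<nu> w] by (simp add: dirder_def)
  have "det3 (s *\<^sub>R pd_u ?g w) (?n w) (d *\<^sub>R pd_v ?n w) = 0"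
    using \<eta>(2)[OF t(1)] unfolding psi_def t(2) 1 2 by simp
  then show "det3 (pd_u ?g w) (?n w) (pd_v ?n w) = 0"
    using w'(3) d(1) by (simp add: det3_triple cross_mult_left)
qed

text \<open>Both fundamental forms transform by congruence with the Jacobian matrix. Numerators and
  denominators are therefore multiplied by the same factor, the square of its determinant.\<close>

lemma curvature_formulas_invariant:
  assumes w: "w \<in> W"
  shows "(form_L f \<nu> (\<phi> w) * form_N f \<nu> (\<phi> w) - (form_M f \<nu> (\<phi> w))\<^sup>2)
      / (form_E f (\<phi> w) * form_G f (\<phi> w) - (form_F f (\<phi> w))\<^sup>2)
    = (form_L (f \<circ> \<phi>) (\<nu> \<circ> \<phi>) w * form_N (f \<circ> \<phi>) (\<nu> \<circ> \<phi>) w - (form_M (f \<circ> \<phi>) (\<nu> \<circ> \<phi>) w)\<^sup>2)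
      / (form_E (f \<circ> \<phi>) w * form_G (f \<circ> \<phi>) w - (form_F (f \<circ> \<phi>) w)\<^sup>2)" (is ?K)
    and "(form_E f (\<phi> w) * form_N f \<nu> (\<phi> w) - 2 * form_F f (\<phi> w) * form_M f \<nu> (\<phi> w)
        + form_G f (\<phi> w) * form_L f \<nu> (\<phi> w))
      / (2 * (form_E f (\<phi> w) * form_G f (\<phi> w) - (form_F f (\<phi> w))\<^sup>2))
    = (form_E (f \<circ> \<phi>) w * form_N (f \<circ> \<phi>) (\<nu> \<circ> \<phi>) w - 2 * form_F (f \<circ> \<phi>) w * form_M (f \<circ> \<phi>) (\<nu> \<circ> \<phi>) w
        + form_G (f \<circ> \<phi>) w * form_L (f \<circ> \<phi>) (\<nu> \<circ> \<phi>) w)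
      / (2 * (form_E (f \<circ> \<phi>) w * form_G (f \<circ> \<phi>) w - (form_F (f \<circ> \<phi>) w)\<^sup>2))" (is ?H)
proof -
  let ?q = "\<phi> w"
  obtain a b where ab: "D\<phi> w (1, 0) = (a, b)" by (cases "D\<phi> w (1, 0)")
  obtain c d where cd: "D\<phi> w (0, 1) = (c, d)" by (cases "D\<phi> w (0, 1)")
  have J: "(a * d - b * c)\<^sup>2 \<noteq> 0" using jacobian[OF w] by (simp add: ab cd det2_def)
  have pd: "pd_u (F \<circ> \<phi>) w = a *\<^sub>R pd_u F ?q + b *\<^sub>R pd_v F ?q"
    "pd_v (F \<circ> \<phi>) w = c *\<^sub>R pd_u F ?q + d *\<^sub>R pd_v F ?q"
    if "smooth_on V F" for F :: "plane \<Rightarrow> real^3"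
    using derivative_compose[OF that w] frechet_derivative_plane[OF
        smooth_on_imp_differentiable[OF that in_chart(2)[OF w]]]
    by (simp_all add: dirder_def[of _ "F \<circ> \<phi>"] ab cd)
  have sym: "pd_u f ?q \<bullet> pd_v \<nu> ?q = - form_M f \<nu> ?q"
    using second_form_symmetric[OF open_V smooth_f unit_normal in_chart(2)[OF w]]
    by (simp add: form_M_def)
  have forms: "pd_u f ?q \<bullet> pd_u f ?q = form_E f ?q" "pd_u f ?q \<bullet> pd_v f ?q = form_F f ?q"
    "pd_v f ?q \<bullet> pd_u f ?q = form_F f ?q" "pd_v f ?q \<bullet> pd_v f ?q = form_G f ?q"
    "pd_u f ?q \<bullet> pd_u \<nu> ?q = - form_L f \<nu> ?q" "pd_v f ?q \<bullet> pd_u \<nu> ?q = - form_M f \<nu> ?q"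
    "pd_v f ?q \<bullet> pd_v \<nu> ?q = - form_N f \<nu> ?q"
    by (simp_all add: form_E_def form_F_def form_G_def form_L_def form_M_def form_N_def inner_commute)
  have "form_E (f \<circ> \<phi>) w = a * a * form_E f ?q + 2 * a * b * form_F f ?q + b * b * form_G f ?q"
    "form_F (f \<circ> \<phi>) w = a * c * form_E f ?q + (a * d + b * c) * form_F f ?q + b * d * form_G f ?q"
    "form_G (f \<circ> \<phi>) w = c * c * form_E f ?q + 2 * c * d * form_F f ?q + d * d * form_G f ?q"
    "form_L (f \<circ> \<phi>) (\<nu> \<circ> \<phi>) w = a * a * form_L f \<nu> ?q + 2 * a * b * form_M f \<nu> ?q + b * b * form_N f \<nu> ?q"
    "form_M (f \<circ> \<phi>) (\<nu> \<circ> \<phi>) w = a * c * form_L f \<nu> ?q + (a * d + b * c) * form_M f \<nu> ?q + b * d * form_N f \<nu> ?q"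
    "form_N (f \<circ> \<phi>) (\<nu> \<circ> \<phi>) w = c * c * form_L f \<nu> ?q + 2 * c * d * form_M f \<nu> ?q + d * d * form_N f \<nu> ?q"
    unfolding form_E_def[of "f \<circ> \<phi>"] form_F_def[of "f \<circ> \<phi>"] form_G_def[of "f \<circ> \<phi>"]
      form_L_def[of "f \<circ> \<phi>"] form_M_def[of "f \<circ> \<phi>"] form_N_def[of "f \<circ> \<phi>"]
      pd[OF smooth_f] pd[OF smooth_\<nu>]
    by (simp_all add: inner_add_left inner_add_right forms sym algebra_simps)
  note t = this
  have "form_E (f \<circ> \<phi>) w * form_G (f \<circ> \<phi>) w - (form_F (f \<circ> \<phi>) w)\<^sup>2
      = (a * d - b * c)\<^sup>2 * (form_E f ?q * form_G f ?q - (form_F f ?q)\<^sup>2)"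
    unfolding t by algebra
  moreover have "form_L (f \<circ> \<phi>) (\<nu> \<circ> \<phi>) w * form_N (f \<circ> \<phi>) (\<nu> \<circ> \<phi>) w - (form_M (f \<circ> \<phi>) (\<nu> \<circ> \<phi>) w)\<^sup>2
      = (a * d - b * c)\<^sup>2 * (form_L f \<nu> ?q * form_N f \<nu> ?q - (form_M f \<nu> ?q)\<^sup>2)"
    unfolding t by algebra
  moreover have "form_E (f \<circ> \<phi>) w * form_N (f \<circ> \<phi>) (\<nu> \<circ> \<phi>) w - 2 * form_F (f \<circ> \<phi>) w * form_M (f \<circ> \<phi>) (\<nu> \<circ> \<phi>) w
        + form_G (f \<circ> \<phi>) w * form_L (f \<circ> \<phi>) (\<nu> \<circ> \<phi>) w
      = (a * d - b * c)\<^sup>2 * (form_E f ?q * form_N f \<nu> ?q - 2 * form_F f ?q * form_M f \<nu> ?q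
        + form_G f ?q * form_L f \<nu> ?q)"
    unfolding t by algebra
  ultimately show ?K ?H using J by simp_all
qed

lemma singular_islimpt:
  assumes "w \<in> W" "snd w = 0"
  shows "\<phi> w islimpt (V - sing_set V f)"
proof (rule islimptI)
  fix T assume T: "\<phi> w \<in> T" "open T"
  have "open (W \<inter> \<phi> -` T)"
    using continuous_open_preimage[OF smooth_on_imp_continuous_on[OF chart(3)] chart(1) T(2)] .
  moreover have "w \<in> W \<inter> \<phi> -` T" using assms T by simp
  ultimately obtain r where r: "r > 0" "ball w r \<subseteq> W \<inter> \<phi> -` T" using openE by blast
  let ?w = "w + (0, r / 2)"
  have "dist w ?w < r" using r by (simp add: dist_norm norm_Pair)
  then have "?w \<in> W" "\<phi> ?w \<in> T" using r by auto
  moreover have "snd ?w \<noteq> 0" using assms r by simp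
  ultimately show "\<exists>y\<in>V - sing_set V f. y \<in> T \<and> y \<noteq> \<phi> w"
    using singular_iff in_chart assms by (metis DiffI)
qed

text \<open>The limit defining the extension exists and is the value of the continuous function \<open>c\<close>; it is
  determined because singular points are limits of regular ones.\<close>

lemma extend_to_singular_chart:
  assumes "\<And>w. w \<in> W \<Longrightarrow> snd w \<noteq> 0 \<Longrightarrow> k (\<phi> w) = c w" "continuous_on W c" "w \<in> W"
  shows "extend_to_singular V f k (\<phi> w) = c w"
proof (cases "snd w = 0")
  case True
  let ?A = "V - sing_set V f"
  have "continuous_on U (\<lambda>q. c (\<theta> q))"
    by (rule continuous_on_compose2[OF assms(2) smooth_on_imp_continuous_on[OF chart(4)]])
      (use \<theta> in auto)
  then have "isCont (\<lambda>q. c (\<theta> q)) (\<phi> w)"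
    using in_chart(1)[OF assms(3)] chart(2) continuous_on_eq_continuous_at by blast
  then have "((\<lambda>q. c (\<theta> q)) \<longlongrightarrow> c w) (at (\<phi> w))"
    using chart(6)[OF assms(3)] by (simp add: isCont_def)
  then have "((\<lambda>q. c (\<theta> q)) \<longlongrightarrow> c w) (at (\<phi> w) within ?A)"
    by (rule tendsto_within_subset) simp
  moreover have "\<forall>\<^sub>F q in at (\<phi> w) within ?A. c (\<theta> q) = k q"
    unfolding eventually_at_topological
  proof (intro exI[of _ U] conjI ballI impI)
    fix q assume q: "q \<in> U" "q \<in> ?A"
    then show "c (\<theta> q) = k q"
      using assms(1)[of "\<theta> q"] \<theta>[OF q(1)] singular_iff[OF \<theta>(1)[OF q(1)]] by simp
  qed (use chart(2) in_chart assms(3) in auto)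
  ultimately have "(k \<longlongrightarrow> c w) (at (\<phi> w) within ?A)" by (rule Lim_transform_eventually)
  then have "Lim (at (\<phi> w) within ?A) k = c w"
    using singular_islimpt[OF assms(3) True] by (intro tendsto_Lim) (simp_all add: trivial_limit_within)
  then show ?thesis using singular_iff[OF assms(3)] True by (simp add: extend_to_singular_def)
next
  case False
  then show ?thesis using assms singular_iff by (simp add: extend_to_singular_def)
qed

lemma curvatures_chart:
  assumes "w \<in> W"
  shows "gauss_curv V f \<nu> (\<phi> w) = gauss w" "mean_curv V f \<nu> (\<phi> w) = mean w"
    "kappa1 V f \<nu> (\<phi> w) = kmax w" "kappa2 V f \<nu> (\<phi> w) = kmin w"
proof -
  show gauss: "gauss_curv V f \<nu> (\<phi> w) = gauss w" unfolding gauss_curv_def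
    using curvature_formulas_invariant(1) curvatures_regular(1)
    by (intro extend_to_singular_chart smooth_on_imp_continuous_on[OF smooth_gauss] assms) metis
  show mean: "mean_curv V f \<nu> (\<phi> w) = mean w" unfolding mean_curv_def
    using curvature_formulas_invariant(2) curvatures_regular(2)
    by (intro extend_to_singular_chart smooth_on_imp_continuous_on[OF smooth_mean] assms) metis
  show "kappa1 V f \<nu> (\<phi> w) = kmax w" "kappa2 V f \<nu> (\<phi> w) = kmin w"
    by (simp_all add: kappa1_def kappa2_def kmax_def kmin_def disc_def gauss mean)
qed

text \<open>The pair is pulled back to the coordinate domain: iterated derivatives along \<open>\<xi>\<close> and \<open>\<eta>\<close> become
  iterated derivatives along the pulled-back fields, which on the axis are multiples of \<open>\<partial>\<^sub>u\<close>
  and \<open>\<partial>\<^sub>v\<close>.\<close>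

lemma cuspidal_torsion_eq:
  assumes pair: "adapted_pair V f U \<epsilon> \<gamma> \<xi> \<eta>" and w: "w \<in> W" "snd w = 0"
  shows "cuspidal_torsion f \<xi> \<eta> (\<phi> w) = M w"
proof -
  have \<xi>: "smooth_on U \<xi>" and \<eta>: "null_vector_field V f U \<eta>" "smooth_on U \<eta>"
    and pos: "\<And>q. q \<in> U \<Longrightarrow> det2 (\<xi> q) (\<eta> q) > 0"
    and tan: "\<And>t. t \<in> {-\<epsilon><..<\<epsilon>} \<Longrightarrow> \<exists>c. \<xi> (\<gamma> t) = c *\<^sub>R velocity \<gamma> t"
    using pair by (auto simp: adapted_pair_def null_vector_field_def)
  define pull where "pull Z = dirder Z \<theta> \<circ> \<phi>" for Z :: "plane \<Rightarrow> plane"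
  have smooth_pull: "smooth_on W (pull Z)" if "smooth_on U Z" for Z
    unfolding pull_def
    using smooth_on_compose[OF chart(1,2) _ smooth_on_dirder[OF chart(2,4) that] chart(3)] chart(5)
    by blast
  have push: "D\<phi> q (pull Z q) = Z (\<phi> q)" if "q \<in> W" for q Z
    using D\<phi>_D\<theta>[OF that] by (simp add: pull_def dirder_def)
  have pull: "pull Z q = X" if "q \<in> W" "Z (\<phi> q) = D\<phi> q X" for q Z X
    using D\<theta>_D\<phi>[OF that(1)] that(2) by (simp add: pull_def dirder_def)
  have transfer: "dirder Z F (\<phi> q) = dirder (pull Z) H q"
    if "smooth_on U F" "\<And>x. x \<in> W \<Longrightarrow> F (\<phi> x) = H x" "q \<in> W" for Z F q and H :: "plane \<Rightarrow> real^3"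
  proof -
    have F: "F differentiable (at (\<phi> q))"
      using smooth_on_imp_differentiable[OF that(1)] in_chart that(3) by blast
    have "dirder Z F (\<phi> q) = dirder (pull Z) (F \<circ> \<phi>) q"
      by (rule dirder_compose[of F \<phi> q "pull Z" Z, OF F \<phi>_differentiable[OF that(3)] push[OF that(3)]])
    also have "\<dots> = dirder (pull Z) H q"
      by (rule dirder_cong[OF chart(1) that(3) differentiable_chain_at[OF \<phi>_differentiable[OF that(3)] F]])
        (use that(2) in auto)
    finally show ?thesis .
  qed
  have sf: "smooth_on U f" by (rule smooth_on_subset[OF smooth_f curve(1)])
  note sd = smooth_on_dirder[OF chart(2)]
  have d1: "dirder Z f (\<phi> q) = dirder (pull Z) (f \<circ> \<phi>) q" if "q \<in> W" for Z q
    by (rule transfer[OF sf _ that]) simp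
  have d2: "dirder Z' (dirder Z f) (\<phi> q) = dirder (pull Z') (dirder (pull Z) (f \<circ> \<phi>)) q"
    if "q \<in> W" "smooth_on U Z" for Z Z' q
    by (rule transfer[OF sd[OF sf that(2)] d1 that(1)])
  have d3: "dirder \<xi> (dirder \<eta> (dirder \<eta> f)) (\<phi> w)
      = dirder (pull \<xi>) (dirder (pull \<eta>) (dirder (pull \<eta>) (f \<circ> \<phi>))) w"
    by (rule transfer[OF sd[OF sd[OF sf \<eta>(2)] \<eta>(2)] d2[OF _ \<eta>(2)] w(1)])
  have "cuspidal_torsion f \<xi> \<eta> (\<phi> w) = cuspidal_torsion (f \<circ> \<phi>) (pull \<xi>) (pull \<eta>) w"
    unfolding cuspidal_torsion_def d1[OF w(1)] d2[OF w(1) \<xi>] d2[OF w(1) \<eta>(2)] d3 ..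
  also have "\<dots> = M w"
  proof (rule cuspidal_torsion_chart[OF smooth_pull[OF \<xi>] _ smooth_pull[OF \<eta>(2)] _ w])
    have tangent: "\<exists>a. \<xi> (\<phi> q) = D\<phi> q (a, 0)" if q: "q \<in> W" "snd q = 0" for q
    proof -
      obtain t where t: "t \<in> {-\<epsilon><..<\<epsilon>}" "\<gamma> t = \<phi> q" using axis_in_curve[OF q] .
      obtain w' s where w': "w' \<in> W" "\<gamma> t = \<phi> w'" "velocity \<gamma> t = D\<phi> w' (s, 0)"
        using curve_in_chart[OF t(1)] by metis
      have "w' = q" using chart(6) q w'(1,2) t(2) by metis
      moreover obtain c where "\<xi> (\<gamma> t) = c *\<^sub>R velocity \<gamma> t" using tan[OF t(1)] by blast
      ultimately have "\<xi> (\<phi> q) = D\<phi> q (c *\<^sub>R (s, 0))"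
        using t(2) w'(3) linear_scale[OF linear_D\<phi>[OF q(1)]] by (simp del: scaleR_Pair)
      then show ?thesis by auto
    qed
    show "snd (pull \<xi> q) = 0" if "q \<in> W" "snd q = 0" for q
      using tangent[OF that] pull[OF that(1)] by fastforce
    show "fst (pull \<eta> q) = 0" if "q \<in> W" "snd q = 0" for q
      using null_field[OF \<eta>(1) that] pull[OF that(1)] by (metis fst_conv)
    show "snd (pull \<eta> w) \<noteq> 0"
      using null_field[OF \<eta>(1) w] pull[OF w(1)] by (metis snd_conv)
    obtain a where a: "\<xi> (\<phi> w) = D\<phi> w (a, 0)" using tangent[OF w] by blast
    have "\<xi> (\<phi> w) \<noteq> 0" using pos[OF in_chart(1)[OF w(1)]] by (auto simp: det2_def)
    then have "a \<noteq> 0" using a linear_0[OF linear_D\<phi>[OF w(1)]] by (metis zero_prod_def)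
    then show "fst (pull \<xi> w) \<noteq> 0" using pull[of w \<xi>, OF w(1) a] by simp
  qed
  finally show ?thesis .
qed

lemma torsion_along_curve:
  assumes "adapted_pair V f U \<epsilon> \<gamma> \<xi> \<eta>"
  shows "(\<forall>t\<in>{-\<epsilon><..<\<epsilon>}. cuspidal_torsion f \<xi> \<eta> (\<gamma> t) = 0) \<longleftrightarrow> (\<forall>w\<in>W. snd w = 0 \<longrightarrow> M w = 0)"
  using cuspidal_torsion_eq[OF assms] curve_in_chart axis_in_curve by metis

text \<open>On the axis the image of the differential is spanned by \<open>g\<^sub>u\<close>, so the two principal equations
  reduce to \<open>\<kappa> g\<^sub>u \<bullet> g\<^sub>u = - g\<^sub>u \<bullet> n\<^sub>u\<close>.\<close>

lemma principal_vector_axis: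
  assumes w: "w \<in> W" "snd w = 0" and "s \<noteq> 0"
  shows "principal_vector f \<nu> \<kappa> (\<phi> w) (D\<phi> w (s, 0)) \<longleftrightarrow> \<kappa> = L w"
proof -
  let ?gu = "pd_u (f \<circ> \<phi>) w" and ?nu = "pd_u (\<nu> \<circ> \<phi>) w"
  let ?Z = "\<kappa> *\<^sub>R s *\<^sub>R ?gu + s *\<^sub>R ?nu"
  have Z: "\<kappa> *\<^sub>R frechet_derivative f (at (\<phi> w)) (D\<phi> w (s, 0))
      + frechet_derivative \<nu> (at (\<phi> w)) (D\<phi> w (s, 0)) = ?Z"
    using derivative_along[OF smooth_f w(1), of "(s, 0)"]
      derivative_along[OF smooth_\<nu> w(1), of "(s, 0)"] by simp
  have "principal_vector f \<nu> \<kappa> (\<phi> w) (D\<phi> w (s, 0))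
      \<longleftrightarrow> (\<forall>Y. frechet_derivative f (at (\<phi> w)) Y \<bullet> ?Z = 0)"
    unfolding principal_vector_iff[OF open_V smooth_f unit_normal in_chart(2)[OF w(1)]] Z ..
  also have "\<dots> \<longleftrightarrow> (\<forall>X. frechet_derivative f (at (\<phi> w)) (D\<phi> w X) \<bullet> ?Z = 0)"
    using D\<phi>_D\<theta>[OF w(1)] by metis
  also have "\<dots> \<longleftrightarrow> (\<forall>r. r *\<^sub>R ?gu \<bullet> ?Z = 0)"
    unfolding derivative_along[OF smooth_f w(1)] g_v[OF w(1)] w(2)
    by (simp add: split_paired_all)
  also have "\<dots> \<longleftrightarrow> (\<forall>r. r * (s * (\<kappa> - L w)) = 0)"
    using gu_unit[OF w] by (simp add: L_def inner_add_right algebra_simps)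
  also have "\<dots> \<longleftrightarrow> \<kappa> = L w" using \<open>s \<noteq> 0\<close> by (auto dest: spec[of _ 1])
  finally show ?thesis .
qed

text \<open>The tangent of \<open>\<gamma>\<close> is principal exactly when \<open>L\<close> is a principal curvature, that is, a root of
  the characteristic equation.\<close>

lemma curvature_line_iff: "curvature_line V f \<nu> \<epsilon> \<gamma> \<longleftrightarrow> (\<forall>w\<in>W. snd w = 0 \<longrightarrow> M w = 0)"
proof -
  have *: "(\<exists>\<kappa>\<in>{kappa1 V f \<nu> (\<gamma> t), kappa2 V f \<nu> (\<gamma> t)}. principal_vector f \<nu> \<kappa> (\<gamma> t) (velocity \<gamma> t))
      \<longleftrightarrow> M w = 0" if t: "t \<in> {-\<epsilon><..<\<epsilon>}" "\<gamma> t = \<phi> w" "w \<in> W" for t w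
  proof -
    obtain w' s where w': "w' \<in> W" "snd w' = 0" "\<gamma> t = \<phi> w'" "s \<noteq> 0" "velocity \<gamma> t = D\<phi> w' (s, 0)"
      using curve_in_chart[OF t(1)] .
    have "w' = w" using chart(6) t(2,3) w'(1,3) by metis
    then have ax: "snd w = 0" and vel: "velocity \<gamma> t = D\<phi> w (s, 0)" using w' by simp_all
    show ?thesis
      using principal_curvature_axis[OF t(3) ax]
      by (simp add: t(2) vel curvatures_chart(3,4)[OF t(3)]
          principal_vector_axis[OF t(3) ax \<open>s \<noteq> 0\<close>])
  qed
  show ?thesis
  proof
    assume c: "curvature_line V f \<nu> \<epsilon> \<gamma>"
    show "\<forall>w\<in>W. snd w = 0 \<longrightarrow> M w = 0"
    proof (intro ballI impI)
      fix w assume w: "w \<in> W" "snd w = 0"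
      obtain t where t: "t \<in> {-\<epsilon><..<\<epsilon>}" "\<gamma> t = \<phi> w" using axis_in_curve[OF w] .
      show "M w = 0" using c *[OF t w(1)] t(1) unfolding curvature_line_def by blast
    qed
  next
    assume M: "\<forall>w\<in>W. snd w = 0 \<longrightarrow> M w = 0"
    show "curvature_line V f \<nu> \<epsilon> \<gamma>" unfolding curvature_line_def
    proof
      fix t assume t: "t \<in> {-\<epsilon><..<\<epsilon>}"
      obtain w where w: "w \<in> W" "snd w = 0" "\<gamma> t = \<phi> w" using curve_in_chart[OF t] by metis
      then show "\<exists>\<kappa>\<in>{kappa1 V f \<nu> (\<gamma> t), kappa2 V f \<nu> (\<gamma> t)}. principal_vector f \<nu> \<kappa> (\<gamma> t) (velocity \<gamma> t)"
        using *[OF t w(3,1)] M by blast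
    qed
  qed
qed

end

section \<open>Principal vector fields near a pure-frontal singular point\<close>

theorem proposition3p3:
  fixes V U W :: "(real \<times> real) set"
    and f \<nu> h :: "real \<times> real \<Rightarrow> real^3"
    and p :: "real \<times> real"
    and \<epsilon> :: real
    and \<gamma> :: "real \<Rightarrow> real \<times> real"
    and \<phi> \<theta> \<xi> \<eta> V1 V2 :: "real \<times> real \<Rightarrow> real \<times> real"
  assumes "frontal V f"
    and "unit_normal_on V f \<nu>"
    and "pure_frontal V f \<nu> p U \<epsilon> \<gamma>"
    and "\<not> umbilic V f \<nu> p"
    and "orthogonal_adapted_coordinates V f U \<epsilon> \<gamma> W \<phi> \<theta>"
    and "0 \<in> W" and "\<phi> 0 = p"
    and "\<And>w. w \<in> W \<Longrightarrow> snd w = 0 \<Longrightarrow>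
           det3 (pd_u (f \<circ> \<phi>) w) (pd_v (pd_v (f \<circ> \<phi>)) w) ((\<nu> \<circ> \<phi>) w) > 0"
    and "smooth_on W h"
    and "\<And>w. w \<in> W \<Longrightarrow> pd_v (f \<circ> \<phi>) w = snd w *\<^sub>R h w"
    and "adapted_pair V f U \<epsilon> \<gamma> \<xi> \<eta>"
    and "\<And>t. t \<in> {-\<epsilon><..<\<epsilon>} \<Longrightarrow>
           det3 (dirder \<xi> f (\<gamma> t)) (dirder \<eta> (dirder \<eta> f) (\<gamma> t)) (\<nu> (\<gamma> t)) > 0"
    and "V1 = principal_field (f \<circ> \<phi>) (\<nu> \<circ> \<phi>) h (kappa1 V f \<nu> \<circ> \<phi>)"
    and "V2 = principal_field (f \<circ> \<phi>) (\<nu> \<circ> \<phi>) h (kappa2 V f \<nu> \<circ> \<phi>)"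
  shows "(\<exists>N. open N \<and> 0 \<in> N \<and> N \<subseteq> W \<and> smooth_on N V1 \<and> smooth_on N V2) \<and>
    (cuspidal_torsion f \<xi> \<eta> p \<noteq> 0 \<longrightarrow>
       V1 0 \<noteq> 0 \<and> V2 0 \<noteq> 0 \<and>
       parallel (frechet_derivative \<phi> (at 0) (V1 0)) (\<eta> p) \<and>
       parallel (frechet_derivative \<phi> (at 0) (V2 0)) (\<eta> p)) \<and>
    ((\<forall>t\<in>{-\<epsilon><..<\<epsilon>}. cuspidal_torsion f \<xi> \<eta> (\<gamma> t) = 0) \<longrightarrow>
       (\<exists>N W1 W2. open N \<and> 0 \<in> N \<and> N \<subseteq> W \<and> smooth_on N W1 \<and> smooth_on N W2 \<and>
          (\<forall>w\<in>N. \<not> parallel (W1 w) (W2 w) \<and> parallel (V1 w) (W1 w) \<and> parallel (V2 w) (W2 w)))) \<and>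
    (\<forall>\<eta>'. adapted_pair V f U \<epsilon> \<gamma> \<xi> \<eta>' \<longrightarrow> bias_normalized f \<epsilon> \<gamma> \<xi> \<eta>' \<longrightarrow>
       (\<forall>t\<in>{-\<epsilon><..<\<epsilon>}. bias f \<xi> \<eta>' (\<gamma> t) / 3 - limiting_normal_curvature f \<nu> \<gamma> t \<noteq> 0) \<longrightarrow>
       (curvature_line V f \<nu> \<epsilon> \<gamma> \<longleftrightarrow>
          (\<forall>t\<in>{-\<epsilon><..<\<epsilon>}. cuspidal_torsion f \<xi> \<eta> (\<gamma> t) = 0)))"
proof -
  interpret orthogonal_frontal_chart V U W f \<nu> h p \<epsilon> \<gamma> \<phi> \<theta>
    by unfold_locales (fact assms)+
  let ?V = "principal_field (f \<circ> \<phi>) (\<nu> \<circ> \<phi>) h"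
  have V: "V1 w = ?V kmax w" "V2 w = ?V kmin w" if "w \<in> W" for w
    using curvatures_chart(3,4)[OF that] by (simp_all add: assms(13,14) principal_field_eq)
  have axis0: "snd (0 :: plane) = 0" by simp
  have M_p: "cuspidal_torsion f \<xi> \<eta> p = M 0"
    using cuspidal_torsion_eq[OF assms(11) \<open>0 \<in> W\<close> axis0] \<open>\<phi> 0 = p\<close> by simp
  have M_axis: "(\<forall>t\<in>{-\<epsilon><..<\<epsilon>}. cuspidal_torsion f \<xi> \<eta> (\<gamma> t) = 0) \<longleftrightarrow> (\<forall>w\<in>W. snd w = 0 \<longrightarrow> M w = 0)"
    by (rule torsion_along_curve[OF assms(11)])
  have "disc 0 \<noteq> 0"
    using \<open>\<not> umbilic V f \<nu> p\<close> curvatures_chart(1,2)[OF \<open>0 \<in> W\<close>] \<open>\<phi> 0 = p\<close>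
    by (simp add: umbilic_def disc_def)
  then have disc: "disc 0 > 0" using disc_axis[OF \<open>0 \<in> W\<close> axis0] by (simp add: less_le)
  define S where "S = W \<inter> disc -` {0<..}"
  have S: "open S" "0 \<in> S" "S \<subseteq> W" "\<And>w. w \<in> S \<Longrightarrow> disc w > 0"
    using continuous_open_preimage[OF smooth_on_imp_continuous_on[OF smooth_disc] open_W] disc \<open>0 \<in> W\<close>
    by (auto simp: S_def)
  note smooth_k = smooth_principal_curvatures[OF S(1,3,4)]
  have smooth_V: "smooth_on S (?V kmax)" "smooth_on S (?V kmin)"
    using smooth_principal_field[OF S(1,3)] smooth_k by blast+
  have "smooth_on S V1" by (rule smooth_on_cong[OF S(1) smooth_V(1)]) (metis V(1) S(3) subsetD)
  moreover have "smooth_on S V2" by (rule smooth_on_cong[OF S(1) smooth_V(2)]) (metis V(2) S(3) subsetD)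
  ultimately have 0: "\<exists>N. open N \<and> 0 \<in> N \<and> N \<subseteq> W \<and> smooth_on N V1 \<and> smooth_on N V2"
    using S by blast
  have V0: "V1 0 = (0, L 0 - kmax 0)" "V2 0 = (0, L 0 - kmin 0)"
    using V[OF \<open>0 \<in> W\<close>] axis_values[OF \<open>0 \<in> W\<close> axis0] by (simp_all add: principal_field_eq)
  have "null_vector_field V f U \<eta>" using assms(11) by (simp add: adapted_pair_def)
  from null_field[OF this \<open>0 \<in> W\<close> axis0]
  obtain d where d: "\<eta> p = frechet_derivative \<phi> (at 0) (0, d)"
    using \<open>\<phi> 0 = p\<close> by metis
  have "parallel (frechet_derivative \<phi> (at 0) (0, x)) (\<eta> p)" for x
    unfolding parallel_iff d pd_scale(2)[OF \<open>0 \<in> W\<close>, of x] pd_scale(2)[OF \<open>0 \<in> W\<close>, of d]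
    by (simp add: det2_def)
  then have 1: "V1 0 \<noteq> 0 \<and> V2 0 \<noteq> 0 \<and> parallel (frechet_derivative \<phi> (at 0) (V1 0)) (\<eta> p) \<and>
      parallel (frechet_derivative \<phi> (at 0) (V2 0)) (\<eta> p)" if "cuspidal_torsion f \<xi> \<eta> p \<noteq> 0"
    using that principal_curvature_axis[OF \<open>0 \<in> W\<close> axis0] by (simp add: M_p V0 prod_eq_iff)
  have 2: "\<exists>N W1 W2. open N \<and> 0 \<in> N \<and> N \<subseteq> W \<and> smooth_on N W1 \<and> smooth_on N W2 \<and>
      (\<forall>w\<in>N. \<not> parallel (W1 w) (W2 w) \<and> parallel (V1 w) (W1 w) \<and> parallel (V2 w) (W2 w))"
    if "\<forall>w\<in>W. snd w = 0 \<longrightarrow> M w = 0"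
  proof -
    have M0: "M w = 0" if "w \<in> W" "snd w = 0" for w using that \<open>\<forall>w\<in>W. _\<close> by blast
    have char: "characteristic (kmax w) w" "characteristic (kmin w) w" if "w \<in> S" for w
      using characteristic_iff[OF subsetD[OF S(3) that] less_imp_le[OF S(4)[OF that]]] by simp_all
    have self: "det2 X X = 0" for X by (simp add: det2_def)
    have swap: "det2 X Y = - det2 Y X" for X Y by (simp add: det2_def)
    have ne: "kmax 0 \<noteq> kmin 0" using disc by (simp add: kmax_def kmin_def)
    \<comment> \<open>At the origin the characteristic equation has the root \<open>L\<close>, and its two roots differ there.\<close>
    consider "kmax 0 = L 0" "kmin 0 \<noteq> L 0" | "kmin 0 = L 0" "kmax 0 \<noteq> L 0"
      using principal_curvature_axis[OF \<open>0 \<in> W\<close> axis0] M0[OF \<open>0 \<in> W\<close> axis0] ne by metis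
    then show ?thesis
    proof cases
      case 1
      obtain T X where T: "open T" "0 \<in> T" "T \<subseteq> S" "smooth_on T X"
        "\<And>w. w \<in> T \<Longrightarrow> det2 (X w) (?V kmin w) \<noteq> 0" "\<And>w. w \<in> T \<Longrightarrow> det2 (?V kmax w) (X w) = 0"
        using principal_frame[OF M0 S(1-3) smooth_k char 1] by blast
      have "smooth_on T (?V kmin)" using smooth_V T(3) smooth_on_subset by blast
      moreover have "\<not> parallel (X w) (?V kmin w) \<and> parallel (V1 w) (X w) \<and> parallel (V2 w) (?V kmin w)"
        if "w \<in> T" for w
        using T(5,6)[OF that] by (simp add: parallel_iff V[OF subsetD[OF order_trans[OF T(3) S(3)] that]] self)
      ultimately show ?thesis using T S(3)
        by (intro exI[of _ T] exI[of _ X] exI[of _ "?V kmin"]) auto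
    next
      case 2
      obtain T X where T: "open T" "0 \<in> T" "T \<subseteq> S" "smooth_on T X"
        "\<And>w. w \<in> T \<Longrightarrow> det2 (X w) (?V kmax w) \<noteq> 0" "\<And>w. w \<in> T \<Longrightarrow> det2 (?V kmin w) (X w) = 0"
        using principal_frame[OF M0 S(1-3) smooth_k(2,1) char(2,1) 2] by blast
      have "smooth_on T (?V kmax)" using smooth_V T(3) smooth_on_subset by blast
      moreover have "\<not> parallel (?V kmax w) (X w) \<and> parallel (V1 w) (?V kmax w) \<and> parallel (V2 w) (X w)"
        if "w \<in> T" for w
        using T(5,6)[OF that] swap[of "X w" "?V kmax w"]
        by (simp add: parallel_iff V[OF subsetD[OF order_trans[OF T(3) S(3)] that]] self)
      ultimately show ?thesis using T S(3)
        by (intro exI[of _ T] exI[of _ "?V kmax"] exI[of _ X]) auto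
    qed
  qed
  show ?thesis using 0 1 2 unfolding M_axis curvature_line_iff by blast
qed

end
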